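(* Let $n \in \mathbb{N}$, $\mathbb{A} = (A_1,\dots,A_n),\ \mathbb{B} = (B_1,\dots,B_n) \in \mathbb{P}^n$ and $\omega = (w_1,\dots,w_n)\in\Delta_n$. If $A_j \le B_j$ for all $j=1,\dots,n$, then for $0 < p \le 1$ or $-1 \le p < 0$, $$Q_p(\omega;\mathbb{A}) \preceq Q_p(\omega;\mathbb{B}).$$
   Context: $\mathcal{H}$ is a Hilbert space, and $\mathbb{P}$ is the open convex cone of positive definite (positive and invertible) bounded linear operators on $\mathcal{H}$. The Loewner order $X \le Y$ on self-adjoint operators means $Y - X$ is positive semi-definite. The metric geometric mean is $A \# B = A^{1/2}(A^{-1/2} B A^{-1/2})^{1/2}A^{1/2}$ for $A,B\in\mathbb{P}$. The near-order on $\mathbb{P}$ is defined by: $A \preceq B$ if and only if $A^{-1}\# B \ge I$. $\Delta_n$ is the set of probability vectors in $\mathbb{R}^n$ with all entries positive. For $p \in \mathbb{R}\setminus\{0\}$ the quasi-arithmetic mean of order $p$ is $Q_p(\omega;\mathbb{A}) = \left(\sum_{j=1}^n w_j A_j^p\right)^{1/p}$. *)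

theory Defs
  imports "HOL-Analysis.Analysis" "HOL-Computational_Algebra.Polynomial"
begin

text \<open>
  Complex Hilbert spaces. The underlying real Hilbert space supplies the norm, the topology and
  completeness; its inner product is the real part of the complex one. The complex inner product
  is conjugate-linear in the first argument.
\<close>

class complex_hilbert_space = real_inner + complete_space +
  fixes scaleC :: "complex \<Rightarrow> 'a \<Rightarrow> 'a"  (infixr \<open>*\<^sub>C\<close> 75)
    and cinner :: "'a \<Rightarrow> 'a \<Rightarrow> complex"
  assumes scaleC_add_right: "c *\<^sub>C (x + y) = c *\<^sub>C x + c *\<^sub>C y"
    and scaleC_add_left: "(c + d) *\<^sub>C x = c *\<^sub>C x + d *\<^sub>C x"
    and scaleC_scaleC: "c *\<^sub>C d *\<^sub>C x = (c * d) *\<^sub>C x"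
    and scaleC_of_real: "complex_of_real r *\<^sub>C x = r *\<^sub>R x"
    and cinner_commute: "cinner x y = cnj (cinner y x)"
    and cinner_add_right: "cinner x (y + z) = cinner x y + cinner x z"
    and cinner_scaleC_right: "cinner x (c *\<^sub>C y) = c * cinner x y"
    and Re_cinner: "Re (cinner x y) = inner x y"

subclass (in complex_hilbert_space) banach ..

instantiation complex :: complex_hilbert_space
begin

definition scaleC_complex :: "complex \<Rightarrow> complex \<Rightarrow> complex"
  where "scaleC_complex c x = c * x"

definition cinner_complex :: "complex \<Rightarrow> complex \<Rightarrow> complex"
  where "cinner_complex x y = cnj x * y"

instance
  by standard
    (simp_all add: scaleC_complex_def cinner_complex_def inner_complex_def algebra_simps
      scaleR_conv_of_real)

end

text \<open>
  The type \<open>'a \<Rightarrow>\<^sub>L 'a\<close> consists of the bounded real-linear operators with the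
  operator norm; the bounded linear operators on the complex space are those satisfying
  \<open>complex_linear\<close>.
\<close>

definition complex_linear :: "('a::complex_hilbert_space \<Rightarrow>\<^sub>L 'a) \<Rightarrow> bool"
  where "complex_linear A \<longleftrightarrow> (\<forall>c x. A (c *\<^sub>C x) = c *\<^sub>C A x)"

definition self_adjoint :: "('a::complex_hilbert_space \<Rightarrow>\<^sub>L 'a) \<Rightarrow> bool"
  where "self_adjoint A \<longleftrightarrow> complex_linear A \<and> (\<forall>x y. cinner (A x) y = cinner x (A y))"

text \<open>For self-adjoint \<open>A\<close> the number \<open>cinner x (A x)\<close> is real.\<close>

definition pos_semidef :: "('a::complex_hilbert_space \<Rightarrow>\<^sub>L 'a) \<Rightarrow> bool"
  where "pos_semidef A \<longleftrightarrow> self_adjoint A \<and> (\<forall>x. 0 \<le> Re (cinner x (A x)))"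

definition op_invertible :: "('a::real_normed_vector \<Rightarrow>\<^sub>L 'a) \<Rightarrow> bool"
  where "op_invertible A \<longleftrightarrow> (\<exists>B. A o\<^sub>L B = id_blinfun \<and> B o\<^sub>L A = id_blinfun)"

definition op_inverse :: "('a::real_normed_vector \<Rightarrow>\<^sub>L 'a) \<Rightarrow> ('a \<Rightarrow>\<^sub>L 'a)"
  where "op_inverse A = (THE B. A o\<^sub>L B = id_blinfun \<and> B o\<^sub>L A = id_blinfun)"

definition pos_def :: "('a::complex_hilbert_space \<Rightarrow>\<^sub>L 'a) set"
  where "pos_def = {A. pos_semidef A \<and> op_invertible A}"

definition loewner_le :: "('a::complex_hilbert_space \<Rightarrow>\<^sub>L 'a) \<Rightarrow> ('a \<Rightarrow>\<^sub>L 'a) \<Rightarrow> bool"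
    (infix \<open>\<le>\<^sub>L\<close> 50)
  where "X \<le>\<^sub>L Y \<longleftrightarrow> self_adjoint X \<and> self_adjoint Y \<and> pos_semidef (Y - X)"

text \<open>
  The set of all complex \<open>z\<close> for which \<open>A - z I\<close> has no bounded two-sided inverse. For
  complex-linear \<open>A\<close> an inverse \<open>B\<close> is automatically complex-linear.
\<close>

definition spectrum :: "('a::complex_hilbert_space \<Rightarrow>\<^sub>L 'a) \<Rightarrow> complex set"
  where "spectrum A =
    {z. \<not> (\<exists>B :: 'a \<Rightarrow>\<^sub>L 'a. \<forall>x. B (A x - z *\<^sub>C x) = x \<and> A (B x) - z *\<^sub>C B x = x)}"

definition op_poly :: "real poly \<Rightarrow> ('a::real_normed_vector \<Rightarrow>\<^sub>L 'a) \<Rightarrow> ('a \<Rightarrow>\<^sub>L 'a)"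
  where "op_poly q A = (\<Sum>i\<le>degree q. coeff q i *\<^sub>R (((o\<^sub>L) A) ^^ i) id_blinfun)"

text \<open>
  Continuous functional calculus for a self-adjoint operator \<open>A\<close> and a real function \<open>f\<close>
  continuous on the (compact, real) spectrum of \<open>A\<close>: the common norm limit of \<open>q\<^sub>k(A)\<close> over
  all sequences of polynomials \<open>q\<^sub>k\<close> converging to \<open>f\<close> uniformly on the spectrum.
\<close>

definition op_fun :: "(real \<Rightarrow> real) \<Rightarrow> ('a::complex_hilbert_space \<Rightarrow>\<^sub>L 'a) \<Rightarrow> ('a \<Rightarrow>\<^sub>L 'a)"
  where "op_fun f A = (THE T. \<forall>q :: nat \<Rightarrow> real poly.
    uniform_limit {x. complex_of_real x \<in> spectrum A} (\<lambda>k. poly (q k)) f sequentially \<longrightarrow>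
    (\<lambda>k. op_poly (q k) A) \<longlonglongrightarrow> T)"

definition op_powr :: "('a::complex_hilbert_space \<Rightarrow>\<^sub>L 'a) \<Rightarrow> real \<Rightarrow> ('a \<Rightarrow>\<^sub>L 'a)"
  where "op_powr A p = op_fun (\<lambda>x. x powr p) A"

definition geometric_mean ::
    "('a::complex_hilbert_space \<Rightarrow>\<^sub>L 'a) \<Rightarrow> ('a \<Rightarrow>\<^sub>L 'a) \<Rightarrow> ('a \<Rightarrow>\<^sub>L 'a)"
  where "geometric_mean A B =
    op_powr A (1/2) o\<^sub>L
      op_powr (op_powr A (- 1/2) o\<^sub>L B o\<^sub>L op_powr A (- 1/2)) (1/2) o\<^sub>L op_powr A (1/2)"

text \<open>A relation on \<open>pos_def\<close>; in particular it only holds between members of that set.\<close>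

definition near_le :: "('a::complex_hilbert_space \<Rightarrow>\<^sub>L 'a) \<Rightarrow> ('a \<Rightarrow>\<^sub>L 'a) \<Rightarrow> bool"
    (infix \<open>\<preceq>\<^sub>N\<close> 50)
  where "A \<preceq>\<^sub>N B \<longleftrightarrow>
    A \<in> pos_def \<and> B \<in> pos_def \<and> id_blinfun \<le>\<^sub>L geometric_mean (op_inverse A) B"

text \<open>An \<open>n\<close>-tuple is a function on \<open>nat\<close> of which only the values on \<open>{1..n}\<close> matter.\<close>

definition pos_prob_vectors :: "nat \<Rightarrow> (nat \<Rightarrow> real) set"
  where "pos_prob_vectors n = {w. (\<forall>j\<in>{1..n}. 0 < w j) \<and> (\<Sum>j=1..n. w j) = 1}"

definition quasi_arith_mean ::
    "real \<Rightarrow> nat \<Rightarrow> (nat \<Rightarrow> real) \<Rightarrow> (nat \<Rightarrow> 'a::complex_hilbert_space \<Rightarrow>\<^sub>L 'a) \<Rightarrow> ('a \<Rightarrow>\<^sub>L 'a)"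
  where "quasi_arith_mean p n w A = op_powr (\<Sum>j=1..n. w j *\<^sub>R op_powr (A j) p) (1 / p)"

end

theory Submission
  imports Defs "HOL-Computational_Algebra.Fundamental_Theorem_Algebra"
begin

text \<open>
  The proof rests on the Riccati description of the geometric mean: \<open>P\<^sup>-\<^sup>1 # Q\<close> is the unique
  positive definite \<open>G\<close> with \<open>G P G = Q\<close>. Therefore \<open>P \<preceq>\<^sub>N Q\<close> holds as soon as
  \<open>Q = G P G\<close> for some \<open>G \<ge> I\<close> (lemma \<open>near_leI\<close>), and the solutions can be compared by
  \<open>riccati_comparison\<close>: if \<open>G R G \<le> H R H\<close> then \<open>G \<le> H\<close>. That lemma is operator monotonicity
  of the square root after a conjugation, and the square root is treated through a Lyapunov
  inequality: if \<open>P\<close> is positive definite and \<open>K P + P K \<ge> 0\<close>, then \<open>K \<ge> 0\<close>.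

  The comparison is used twice. First, it shows that the set of exponents \<open>p\<close> with
  \<open>A\<^sup>p \<le> B\<^sup>p\<close> is closed under midpoints, which gives the Loewner--Heinz inequality for
  \<open>0 \<le> p \<le> 1\<close>. Second, it shows that \<open>Y\<^sup>q = G X\<^sup>q G\<close> with \<open>G \<ge> I\<close> can be upgraded from
  \<open>q\<close> to \<open>2 q\<close>, because then \<open>Y\<^sup>2\<^sup>q = G X\<^sup>q G\<^sup>2 X\<^sup>q G \<ge> G X\<^sup>2\<^sup>q G\<close>. Starting from
  \<open>q \<le> 1\<close>, where Loewner--Heinz applies, \<open>X \<le> Y\<close> yields such a factor for every
  exponent \<open>q \<ge> 0\<close> (lemma \<open>near_power\<close>).

  For \<open>p > 0\<close> the weighted sums \<open>X\<close> and \<open>Y\<close> of the powers \<open>A\<^sub>j\<^sup>p\<close> and \<open>B\<^sub>j\<^sup>p\<close> satisfy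
  \<open>X \<le> Y\<close>, and \<open>near_power\<close> with \<open>q = 1 / p\<close> gives the claim. For \<open>p < 0\<close> inversion reverses
  the order, so \<open>Y \<le> X\<close>; the factor for \<open>q = - 1 / p\<close> satisfies \<open>G Y\<^sup>q G = X\<^sup>q\<close>, and
  inverting this equation gives \<open>G X\<^sup>-\<^sup>q G = Y\<^sup>-\<^sup>q\<close>.

  The powers are defined by limits of polynomials that converge uniformly on the spectrum alone, so
  the continuous functional calculus has to be developed first. Its core is the
  estimate \<open>norm_op_poly_le\<close>, which bounds \<open>q(A)\<close> by the values of \<open>q\<close> on the real spectrum. It
  combines two facts about self-adjoint operators: \<open>T\<^sup>2 - (norm T)\<^sup>2\<close> is never invertible unless
  \<open>T = 0\<close>, and \<open>r(A)\<close> can fail to be invertible only if \<open>r\<close> vanishes somewhere on the real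
  spectrum.
\<close>

section \<open>Self-adjoint operators and the real inner product\<close>

lemma cinner_eq_iff_inner:
  "cinner x y = cinner u v \<longleftrightarrow> inner x y = inner u v \<and> inner x ((-\<i>) *\<^sub>C y) = inner u ((-\<i>) *\<^sub>C v)"
  by (simp add: complex_eq_iff cinner_scaleC_right flip: Re_cinner)

text \<open>
  The complex inner product is recovered from its real part by
  \<open>Im (cinner x y) = inner x (- \<i> y)\<close>, so for complex-linear operators symmetry with respect to
  the real inner product already is self-adjointness. This allows all later arguments to be carried
  out in the underlying real Hilbert space.
\<close>

lemma self_adjoint_iff:
  "self_adjoint A \<longleftrightarrow> complex_linear A \<and> (\<forall>x y. inner (A x) y = inner x (A y))"
proof
  assume "complex_linear A \<and> (\<forall>x y. inner (A x) y = inner x (A y))"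
  then show "self_adjoint A"
    unfolding self_adjoint_def cinner_eq_iff_inner by (metis complex_linear_def)
qed (metis Re_cinner self_adjoint_def)

lemma self_adjoint_inner: "self_adjoint A \<Longrightarrow> inner (A x) y = inner x (A y)"
  by (simp add: self_adjoint_iff)

lemma scaleC_real_commute: "c *\<^sub>C (r *\<^sub>R x) = r *\<^sub>R (c *\<^sub>C x)"
  by (simp add: scaleC_scaleC mult.commute flip: scaleC_of_real)

lemma self_adjoint_add: "self_adjoint A \<Longrightarrow> self_adjoint B \<Longrightarrow> self_adjoint (A + B)"
  by (simp add: self_adjoint_iff complex_linear_def blinfun.bilinear_simps scaleC_add_right
      inner_add_left inner_add_right)

lemma self_adjoint_scaleR: "self_adjoint A \<Longrightarrow> self_adjoint (r *\<^sub>R A)"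
  by (simp add: self_adjoint_iff complex_linear_def blinfun.bilinear_simps scaleC_real_commute)

lemma self_adjoint_diff: "self_adjoint A \<Longrightarrow> self_adjoint B \<Longrightarrow> self_adjoint (A - B)"
  using self_adjoint_add[of A "(-1) *\<^sub>R B"] self_adjoint_scaleR[of B "-1"] by simp

lemma self_adjoint_id: "self_adjoint id_blinfun"
  by (simp add: self_adjoint_iff complex_linear_def)

lemma self_adjoint_zero: "self_adjoint 0"
  using self_adjoint_scaleR[OF self_adjoint_id, of 0] by simp

lemma self_adjoint_compose:
  assumes "self_adjoint A" "self_adjoint B" "\<And>x. A (B x) = B (A x)"
  shows "self_adjoint (A o\<^sub>L B)"
  using assms by (simp add: self_adjoint_iff complex_linear_def)

lemma self_adjoint_sandwich:
  "self_adjoint S \<Longrightarrow> self_adjoint T \<Longrightarrow> self_adjoint (S o\<^sub>L T o\<^sub>L S)"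
  by (simp add: self_adjoint_iff complex_linear_def)

lemma bounded_linear_scaleC: "bounded_linear (\<lambda>x::'a::complex_hilbert_space. c *\<^sub>C x)"
proof (rule bounded_linear_intro[where K = "cmod c"])
  fix x :: 'a
  have "cinner (c *\<^sub>C x) (c *\<^sub>C x) = c * cnj c * cnj (cinner x x)"
    using cinner_commute[of "c *\<^sub>C x" x] by (simp add: cinner_scaleC_right)
  then have "inner (c *\<^sub>C x) (c *\<^sub>C x) = (cmod c)\<^sup>2 * inner x x"
    by (simp add: complex_norm_square[symmetric] flip: Re_cinner of_real_power)
  then have "(norm (c *\<^sub>C x))\<^sup>2 = (norm x * cmod c)\<^sup>2"
    by (simp add: power2_norm_eq_inner power_mult_distrib)
  then show "norm (c *\<^sub>C x) \<le> norm x * cmod c"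
    by (metis norm_ge_zero mult_nonneg_nonneg order_refl power2_eq_iff_nonneg)
qed (simp_all add: scaleC_add_right scaleC_real_commute)

lemma tendsto_blinfun_at: "(F \<longlongrightarrow> T) G \<Longrightarrow> ((\<lambda>k. blinfun_apply (F k) x) \<longlongrightarrow> T x) G"
  by (intro tendsto_intros)

lemma self_adjoint_limit:
  assumes lim: "F \<longlonglongrightarrow> T" and sa: "\<And>k. self_adjoint (F k)"
  shows "self_adjoint T"
  unfolding self_adjoint_iff complex_linear_def
proof (intro conjI allI)
  note ptw = tendsto_blinfun_at[OF lim]
  show "T (c *\<^sub>C x) = c *\<^sub>C T x" for c x
  proof (rule LIMSEQ_unique[OF ptw])
    have "(\<lambda>k. c *\<^sub>C F k x) \<longlonglongrightarrow> c *\<^sub>C T x"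
      by (rule bounded_linear.tendsto[OF bounded_linear_scaleC ptw])
    then show "(\<lambda>k. F k (c *\<^sub>C x)) \<longlonglongrightarrow> c *\<^sub>C T x"
      using sa by (simp add: self_adjoint_iff complex_linear_def)
  qed
  show "inner (T x) y = inner x (T y)" for x y
  proof (rule LIMSEQ_unique)
    show "(\<lambda>k. inner (F k x) y) \<longlonglongrightarrow> inner (T x) y" by (intro tendsto_intros ptw)
    show "(\<lambda>k. inner (F k x) y) \<longlonglongrightarrow> inner x (T y)"
      unfolding self_adjoint_inner[OF sa] by (intro tendsto_intros ptw)
  qed
qed

section \<open>Invertibility and positive definite operators\<close>

lemma op_inverse_eq:
  fixes A :: "'a::real_normed_vector \<Rightarrow>\<^sub>L 'a"
  assumes "A o\<^sub>L B = id_blinfun" "B o\<^sub>L A = id_blinfun"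
  shows "op_inverse A = B"
  unfolding op_inverse_def
proof (rule the_equality)
  fix C assume "A o\<^sub>L C = id_blinfun \<and> C o\<^sub>L A = id_blinfun"
  then show "C = B"
    using assms by (metis blinfun_apply_blinfun_compose blinfun_apply_id_blinfun blinfun_eqI id_apply)
qed (use assms in simp)

lemma op_invertibleE:
  fixes A :: "'a::real_normed_vector \<Rightarrow>\<^sub>L 'a"
  assumes "op_invertible A"
  obtains B :: "'a \<Rightarrow>\<^sub>L 'a" where "\<And>x. A (B x) = x" "\<And>x. B (A x) = x"
proof -
  obtain B where "A o\<^sub>L B = id_blinfun" "B o\<^sub>L A = id_blinfun"
    using assms by (auto simp: op_invertible_def)
  then show thesis
    by (intro that[of B])
      (metis blinfun_apply_blinfun_compose blinfun_apply_id_blinfun id_apply)+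
qed

lemma op_invertibleI:
  fixes A B :: "'a::real_normed_vector \<Rightarrow>\<^sub>L 'a"
  shows   "(\<And>x. A (B x) = x) \<Longrightarrow> (\<And>x. B (A x) = x) \<Longrightarrow> op_invertible A"
  unfolding op_invertible_def by (rule exI[of _ B]) (auto intro!: blinfun_eqI)

lemma op_inverse_apply:
  fixes A :: "'a::real_normed_vector \<Rightarrow>\<^sub>L 'a"
  assumes "op_invertible A"
  shows "A (op_inverse A x) = x" "op_inverse A (A x) = x"
proof -
  obtain B :: "'a \<Rightarrow>\<^sub>L 'a" where B: "\<And>x. A (B x) = x" "\<And>x. B (A x) = x"
    using op_invertibleE[OF assms] by blast
  then have "op_inverse A = B"
    by (intro op_inverse_eq) (auto intro!: blinfun_eqI)
  then show "A (op_inverse A x) = x" "op_inverse A (A x) = x"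
    using B by simp_all
qed

lemma op_invertible_compose:
  assumes "op_invertible A" "op_invertible B"
  shows "op_invertible (A o\<^sub>L B)"
  by (rule op_invertibleI[where B = "op_inverse B o\<^sub>L op_inverse A"])
    (simp_all add: op_inverse_apply assms)

lemma op_invertible_uminus: "op_invertible (A :: _ \<Rightarrow>\<^sub>L _) \<Longrightarrow> op_invertible (- A)"
  by (rule op_invertibleI[where B = "- op_inverse A"])
    (simp_all add: blinfun.bilinear_simps op_inverse_apply)

text \<open>
  The Lax--Milgram argument: for small \<open>t\<close> the map \<open>x \<mapsto> x - t (S x - y)\<close> is a contraction, and
  its fixed point solves \<open>S x = y\<close>. Coercivity bounds the inverse by \<open>1 / c\<close>.
\<close>

lemma coercive_invertible:
  fixes S :: "'a::{real_inner, complete_space} \<Rightarrow>\<^sub>L 'a"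
  assumes c: "0 < c" and coercive: "\<And>x. c * (norm x)\<^sup>2 \<le> inner x (S x)"
  shows "op_invertible S"
proof -
  define M where "M = norm S + c + 1"
  (* The factor by which x - t S x contracts satisfies k^2 = 1 - 2 t c + t^2 M^2; this t minimises
     it. Including c in M keeps c t below 1. *)
  define t where "t = c / M\<^sup>2"
  define k where "k = sqrt (1 - c * t)"
  have M: "0 < M" "norm S \<le> M" "c \<le> M" using c norm_ge_zero[of S] by (auto simp: M_def intro: add_nonneg_pos)
  have t: "0 < t" using c M by (simp add: t_def)
  have "c * c \<le> M * M" using M c by (intro mult_mono) auto
  then have ct: "0 \<le> 1 - c * t" "1 - c * t < 1"
    using M c t by (simp_all add: t_def power2_eq_square field_simps)
  then have k: "0 \<le> k" "k < 1" "k\<^sup>2 = 1 - c * t"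
    by (simp_all add: k_def)
  have contr: "norm (x - t *\<^sub>R S x) \<le> k * norm x" for x
  proof (rule power2_le_imp_le)
    have "norm (S x) \<le> M * norm x"
      using norm_blinfun[of S x] M by (meson mult_right_mono norm_ge_zero order_trans)
    then have "(norm (S x))\<^sup>2 \<le> M\<^sup>2 * (norm x)\<^sup>2"
      by (metis norm_ge_zero power_mono power_mult_distrib)
    then have "t\<^sup>2 * (norm (S x))\<^sup>2 \<le> t\<^sup>2 * (M\<^sup>2 * (norm x)\<^sup>2)"
      by (intro mult_left_mono) auto
    also have "\<dots> = (t * c) * (norm x)\<^sup>2"
      using M by (simp add: t_def power2_eq_square)
    finally have 1: "t\<^sup>2 * (norm (S x))\<^sup>2 \<le> (t * c) * (norm x)\<^sup>2" .
    have 2: "t * (c * (norm x)\<^sup>2) \<le> t * inner x (S x)"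
      using coercive[of x] t by (intro mult_left_mono) auto
    have "(norm (x - t *\<^sub>R S x))\<^sup>2 = (norm x)\<^sup>2 - 2 * (t * inner x (S x)) + t\<^sup>2 * (norm (S x))\<^sup>2"
      by (simp add: power2_norm_eq_inner inner_diff_left inner_diff_right
          inner_commute[of "S x" x] power2_eq_square[of t] algebra_simps)
    also have "\<dots> \<le> (norm x)\<^sup>2 - t * c * (norm x)\<^sup>2"
      using 1 2 by (simp add: algebra_simps)
    also have "\<dots> = (k * norm x)\<^sup>2"
      by (simp add: power_mult_distrib k(3) algebra_simps)
    finally show "(norm (x - t *\<^sub>R S x))\<^sup>2 \<le> (k * norm x)\<^sup>2" .
  qed (use k in simp)
  have ex1: "\<exists>!x. S x = y" for y
  proof -
    define f where "f x = x - t *\<^sub>R (S x - y)" for x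
    have "dist (f x) (f z) \<le> k * dist x z" for x z
    proof -
      have "f x - f z = (x - z) - t *\<^sub>R S (x - z)"
        by (simp add: f_def blinfun.bilinear_simps algebra_simps)
      then show ?thesis using contr[of "x - z"] by (simp add: dist_norm)
    qed
    then have "\<exists>!x. f x = x" using banach_fix_type[of k f] k by blast
    moreover have "f x = x \<longleftrightarrow> S x = y" for x
      using t by (simp add: f_def)
    ultimately show ?thesis by simp
  qed
  define B where "B y = (THE x. S x = y)" for y
  have SB: "S (B y) = y" for y
    unfolding B_def by (rule theI'[OF ex1])
  have BS: "B (S x) = x" for x
    using ex1[of "S x"] SB[of "S x"] by blast
  have "bounded_linear B"
  proof (rule bounded_linear_intro[where K = "1 / c"])
    show "B (x + y) = B x + B y" for x y
      using BS[of "B x + B y"] by (simp add: blinfun.bilinear_simps SB)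
    show "B (r *\<^sub>R x) = r *\<^sub>R B x" for r x
      using BS[of "r *\<^sub>R B x"] by (simp add: blinfun.bilinear_simps SB)
    show "norm (B y) \<le> norm y * (1 / c)" for y
    proof -
      have "norm (B y) * (c * norm (B y)) \<le> norm (B y) * norm y"
        using coercive[of "B y"] Cauchy_Schwarz_ineq2[of "B y" y]
        by (simp add: SB power2_eq_square algebra_simps)
      then have "c * norm (B y) \<le> norm y"
        by (cases "norm (B y) = 0") (simp_all add: mult_le_cancel_left)
      then show ?thesis using c by (simp add: field_simps)
    qed
  qed
  then show ?thesis
    by (intro op_invertibleI[where B = "Blinfun B"]) (simp_all add: bounded_linear_Blinfun_apply SB BS)
qed

lemma pos_semidef_iff: "pos_semidef A \<longleftrightarrow> self_adjoint A \<and> (\<forall>x. 0 \<le> inner x (A x))"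
  by (simp add: pos_semidef_def Re_cinner)

text \<open>
  Positivity of the quadratic form at \<open>norm A \<sqdot> x - A x\<close>; the estimate replaces the
  Cauchy--Schwarz inequality for the form \<open>inner x (A y)\<close>.
\<close>

lemma pos_semidef_norm_le:
  assumes "pos_semidef A"
  shows "(norm (A x))\<^sup>2 \<le> norm A * inner x (A x)"
proof -
  have sa: "inner (A u) v = inner u (A v)" and nn: "0 \<le> inner u (A u)" for u v
    using assms by (auto simp: pos_semidef_iff self_adjoint_iff)
  show ?thesis
  proof (cases "norm A = 0")
    case False
    define N where "N = norm A"
    have N: "0 < N" using False by (simp add: N_def)
    have "0 \<le> inner (N *\<^sub>R x - A x) (A (N *\<^sub>R x - A x))" by (rule nn)
    also have "\<dots> = N\<^sup>2 * inner x (A x) - 2 * N * (norm (A x))\<^sup>2 + inner (A x) (A (A x))"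
      by (simp add: blinfun.bilinear_simps inner_diff_left inner_diff_right power2_norm_eq_inner
          sa power2_eq_square[of N] algebra_simps)
    also have "inner (A x) (A (A x)) \<le> norm (A x) * (N * norm (A x))"
      unfolding N_def using Cauchy_Schwarz_ineq2[of "A x" "A (A x)"] norm_blinfun[of A "A x"]
      by (meson abs_ge_self mult_left_mono norm_ge_zero order_trans)
    finally have "N * (norm (A x))\<^sup>2 \<le> N * (N * inner x (A x))"
      by (simp add: power2_eq_square algebra_simps)
    then show ?thesis using N by (simp add: N_def)
  qed (use norm_blinfun[of A x] in simp)
qed

text \<open>
  An inverse \<open>B\<close> gives \<open>norm x \<le> norm B \<sqdot> norm (A x)\<close>, and the previous estimate turns this into
  a lower bound of the quadratic form.
\<close>

lemma pos_def_coercive: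
  fixes A :: "'a::complex_hilbert_space \<Rightarrow>\<^sub>L 'a"
  assumes "A \<in> pos_def"
  obtains m where "0 < m" "\<And>x. m * (norm x)\<^sup>2 \<le> inner x (A x)"
proof -
  have psd: "pos_semidef A" and inv: "op_invertible A" using assms by (auto simp: pos_def_def)
  obtain B :: "'a \<Rightarrow>\<^sub>L 'a" where B: "\<And>x. A (B x) = x" "\<And>x. B (A x) = x" using op_invertibleE[OF inv] by blast
  (* The summand 1 avoids division by zero on the trivial space. *)
  define K where "K = (norm B)\<^sup>2 * norm A + 1"
  have K: "0 < K" by (simp add: K_def add_nonneg_pos)
  have "(norm x)\<^sup>2 \<le> K * inner x (A x)" for x
  proof -
    have "(norm x)\<^sup>2 \<le> (norm B)\<^sup>2 * (norm (A x))\<^sup>2"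
      using norm_blinfun[of B "A x"] by (simp add: B power_mono flip: power_mult_distrib)
    also have "\<dots> \<le> (norm B)\<^sup>2 * (norm A * inner x (A x))"
      by (intro mult_left_mono pos_semidef_norm_le psd) auto
    also have "\<dots> \<le> K * inner x (A x)"
      using psd by (simp add: K_def pos_semidef_iff algebra_simps)
    finally show ?thesis .
  qed
  then show thesis using K by (intro that[of "1 / K"]) (simp_all add: field_simps)
qed

lemma pos_defI:
  assumes "self_adjoint A" "0 < m" "\<And>x. m * (norm x)\<^sup>2 \<le> inner x (A x)"
  shows "A \<in> pos_def"
proof -
  have "0 \<le> inner x (A x)" for x
    using assms(2) assms(3)[of x] by (meson less_imp_le mult_nonneg_nonneg order_trans zero_le_power2)
  then show ?thesis
    using coercive_invertible[of m A] assms by (simp add: pos_def_def pos_semidef_iff)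
qed

lemma pos_defD:
  assumes "A \<in> pos_def"
  shows "self_adjoint A" "op_invertible A" "0 \<le> inner x (A x)" "inner (A x) y = inner x (A y)"
  using assms by (auto simp: pos_def_def pos_semidef_iff self_adjoint_iff)

lemma pos_defI_semidef:
  "self_adjoint A \<Longrightarrow> (\<And>x. 0 \<le> inner x (A x)) \<Longrightarrow> op_invertible A \<Longrightarrow> A \<in> pos_def"
  by (simp add: pos_def_def pos_semidef_iff)

lemma pos_def_add:
  assumes "A \<in> pos_def" "B \<in> pos_def" shows "A + B \<in> pos_def"
proof -
  obtain m where m: "0 < m" "\<And>x. m * (norm x)\<^sup>2 \<le> inner x (A x)"
    using pos_def_coercive[OF assms(1)] by blast
  show ?thesis
  proof (rule pos_defI[OF _ m(1)])
    show "m * (norm x)\<^sup>2 \<le> inner x ((A + B) x)" for x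
      using m(2)[of x] pos_defD(3)[OF assms(2), of x]
      by (simp add: blinfun.bilinear_simps inner_add_right)
  qed (simp add: self_adjoint_add pos_defD assms)
qed

lemma pos_def_scaleR:
  assumes "A \<in> pos_def" "0 < r" shows "r *\<^sub>R A \<in> pos_def"
proof -
  obtain m where m: "0 < m" "\<And>x. m * (norm x)\<^sup>2 \<le> inner x (A x)"
    using pos_def_coercive[OF assms(1)] by blast
  show ?thesis
  proof (rule pos_defI)
    show "r * m * (norm x)\<^sup>2 \<le> inner x ((r *\<^sub>R A) x)" for x
      using m(2)[of x] assms(2) by (simp add: blinfun.bilinear_simps mult.assoc)
  qed (use m assms in \<open>simp_all add: self_adjoint_scaleR pos_defD\<close>)
qed

lemma pos_def_weighted_sum:
  assumes "finite J" "J \<noteq> {}" "\<And>j. j \<in> J \<Longrightarrow> 0 < w j" "\<And>j. j \<in> J \<Longrightarrow> A j \<in> pos_def"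
  shows "(\<Sum>j\<in>J. w j *\<^sub>R A j) \<in> pos_def"
  using assms by (induction J rule: finite_ne_induct) (simp_all add: pos_def_add pos_def_scaleR)

lemma pos_def_op_inverse:
  assumes "A \<in> pos_def" shows "op_inverse A \<in> pos_def"
proof -
  note A = pos_defD[OF assms]
  note inv = op_inverse_apply[OF A(2)]
  have cl: "A (c *\<^sub>C x) = c *\<^sub>C A x" for c x
    using A(1) by (simp add: self_adjoint_iff complex_linear_def)
  show ?thesis
  proof (rule pos_defI_semidef)
    show "self_adjoint (op_inverse A)"
      unfolding self_adjoint_iff complex_linear_def
    proof (intro conjI allI)
      show "op_inverse A (c *\<^sub>C x) = c *\<^sub>C op_inverse A x" for c x
        by (metis cl inv)
      show "inner (op_inverse A x) y = inner x (op_inverse A y)" for x y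
        by (metis A(4) inv(1))
    qed
    show "0 \<le> inner x (op_inverse A x)" for x
      using A(3)[of "op_inverse A x"] by (simp add: inv inner_commute)
    show "op_invertible (op_inverse A)"
      by (rule op_invertibleI[where B = A]) (simp_all add: inv)
  qed
qed

lemma pos_def_sandwich:
  assumes S: "self_adjoint S" "op_invertible S" and T: "T \<in> pos_def"
  shows "S o\<^sub>L T o\<^sub>L S \<in> pos_def"
proof (rule pos_defI_semidef)
  show "self_adjoint (S o\<^sub>L T o\<^sub>L S)" by (simp add: self_adjoint_sandwich S pos_defD T)
  show "0 \<le> inner x ((S o\<^sub>L T o\<^sub>L S) x)" for x
    using pos_defD(3)[OF T, of "S x"] by (simp add: self_adjoint_inner[OF S(1)])
  show "op_invertible (S o\<^sub>L T o\<^sub>L S)"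
    by (intro op_invertible_compose S pos_defD(2)[OF T])
qed

lemma loewner_le_iff:
  "X \<le>\<^sub>L Y \<longleftrightarrow> self_adjoint X \<and> self_adjoint Y \<and> (\<forall>x. inner x (X x) \<le> inner x (Y x))"
  by (auto simp: loewner_le_def pos_semidef_iff blinfun.bilinear_simps inner_diff_right
      self_adjoint_diff)

section \<open>Polynomials in a self-adjoint operator\<close>

lemma op_poly_0: "op_poly 0 A = 0"
  by (simp add: op_poly_def)

lemma op_poly_pCons: "op_poly (pCons a q) A x = a *\<^sub>R x + A (op_poly q A x)"
proof (cases "q = 0")
  case False
  have "op_poly (pCons a q) A x
      = (\<Sum>i\<le>Suc (degree q). coeff (pCons a q) i *\<^sub>R ((((o\<^sub>L) A) ^^ i) id_blinfun) x)"
    using False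
    by (simp add: op_poly_def blinfun.sum_left blinfun.scaleR_left del: sum.atMost_Suc)
  also have "\<dots> = a *\<^sub>R x + (\<Sum>i\<le>degree q. coeff q i *\<^sub>R A (((((o\<^sub>L) A) ^^ i) id_blinfun) x))"
    by (subst sum.atMost_Suc_shift) simp
  also have "\<dots> = a *\<^sub>R x + A (op_poly q A x)"
    by (simp add: op_poly_def blinfun.sum_left blinfun.sum_right blinfun.scaleR_left
        blinfun.scaleR_right)
  finally show ?thesis .
qed (simp add: op_poly_def blinfun.bilinear_simps)

lemma op_poly_add: "op_poly (q + r) A x = op_poly q A x + op_poly r A x"
  by (induction q r rule: poly_induct2)
    (simp_all add: op_poly_0 op_poly_pCons blinfun.bilinear_simps scaleR_add_left)

lemma op_poly_smult: "op_poly (smult c q) A x = c *\<^sub>R op_poly q A x"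
  by (induction q)
    (simp_all add: op_poly_0 op_poly_pCons blinfun.bilinear_simps scaleR_add_right)

lemma op_poly_diff: "op_poly (q - r) A = op_poly q A - op_poly r A"
  using op_poly_add[of q "smult (-1) r" A] op_poly_smult[of "-1" r A]
  by (intro blinfun_eqI) (simp add: blinfun.bilinear_simps)

text \<open>
  Together with the lemmas above, \<open>q \<mapsto> q(A)\<close> is an algebra homomorphism.
\<close>

lemma op_poly_mult: "op_poly (q * r) A x = op_poly q A (op_poly r A x)"
  by (induction q)
    (simp_all add: op_poly_0 op_poly_pCons op_poly_add op_poly_smult blinfun.bilinear_simps)

lemma op_poly_commute:
  fixes A T :: "'a::real_normed_vector \<Rightarrow>\<^sub>L 'a"
  assumes "\<And>x. T (A x) = A (T x)"
  shows "T (op_poly q A x) = op_poly q A (T x)"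
  by (induction q) (simp_all add: op_poly_0 op_poly_pCons blinfun.bilinear_simps assms)

lemma op_poly_linear: "op_poly [:- c, 1:] A = A - c *\<^sub>R id_blinfun"
  by (rule blinfun_eqI) (simp add: op_poly_pCons op_poly_0 blinfun.bilinear_simps)

lemma self_adjoint_op_poly:
  assumes "self_adjoint A"
  shows "self_adjoint (op_poly q A)"
proof (induction q)
  case 0
  then show ?case by (simp add: op_poly_0 self_adjoint_zero)
next
  case (pCons a q)
  have "op_poly (pCons a q) A = a *\<^sub>R id_blinfun + (A o\<^sub>L op_poly q A)"
    by (rule blinfun_eqI) (simp add: op_poly_pCons blinfun.bilinear_simps)
  then show ?case
    using pCons.IH assms
    by (simp add: self_adjoint_add self_adjoint_scaleR self_adjoint_id self_adjoint_compose
        op_poly_commute[of A A])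
qed

definition real_spectrum :: "('a::complex_hilbert_space \<Rightarrow>\<^sub>L 'a) \<Rightarrow> real set"
  where "real_spectrum A = {x. complex_of_real x \<in> spectrum A}"

text \<open>
  On real points the complex spectrum only involves the real scalar multiplication.
\<close>

lemma real_spectrum_iff:
  fixes A :: "'a::complex_hilbert_space \<Rightarrow>\<^sub>L 'a"
  shows "x \<in> real_spectrum A \<longleftrightarrow> \<not> op_invertible (A - x *\<^sub>R id_blinfun)"
proof -
  have blinfun_eq: "X = Y \<longleftrightarrow> (\<forall>v. blinfun_apply X v = Y v)" for X Y :: "'a \<Rightarrow>\<^sub>L 'a"
    by (auto intro: blinfun_eqI)
  have "op_invertible (A - x *\<^sub>R id_blinfun) \<longleftrightarrow>
      (\<exists>B. \<forall>v. blinfun_apply B (A v - x *\<^sub>R v) = v \<and> A (B v) - x *\<^sub>R B v = v)"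
    unfolding op_invertible_def
    by (auto simp: blinfun.bilinear_simps blinfun_eq)
  then show ?thesis
    by (simp add: real_spectrum_def spectrum_def scaleC_of_real)
qed

lemma poly_map_of_real_add:
  "poly (map_poly complex_of_real (p + q)) z
    = poly (map_poly complex_of_real p) z + poly (map_poly complex_of_real q) z"
  by (induction p q rule: poly_induct2) (simp_all add: map_poly_pCons algebra_simps)

lemma poly_map_of_real_mult:
  "poly (map_poly complex_of_real (p * q)) z
    = poly (map_poly complex_of_real p) z * poly (map_poly complex_of_real q) z"
  by (induction p)
    (simp_all add: map_poly_pCons poly_map_of_real_add map_poly_smult algebra_simps)

text \<open>
  A complex root of \<open>r\<close> is either real, which splits off a linear factor, or of the form
  \<open>a + b \<i>\<close> with \<open>b \<noteq> 0\<close>. In the latter case the remainder of \<open>r\<close> modulo the quadratic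
  \<open>(x - a)\<^sup>2 + b\<^sup>2\<close> is a real polynomial of degree at most one vanishing at the root, hence zero.
\<close>

lemma real_poly_factor:
  fixes r :: "real poly"
  assumes "0 < degree r"
  obtains (linear) c s where "r = [:- c, 1:] * s"
    | (quadratic) a b s where "b \<noteq> 0" "r = [:a\<^sup>2 + b\<^sup>2, - 2 * a, 1:] * s"
proof -
  let ?E = "\<lambda>q. poly (map_poly complex_of_real q)"
  have "degree (map_poly complex_of_real r) = degree r"
    by (rule degree_map_poly) auto
  then have "\<not> constant (poly (map_poly complex_of_real r))"
    using assms by (simp add: constant_degree)
  then obtain z where z: "?E r z = 0"
    using fundamental_theorem_of_algebra by blast
  define a b where "a = Re z" and "b = Im z"
  show thesis
  proof (cases "b = 0")
    case True
    have E: "?E q (complex_of_real a) = complex_of_real (poly q a)" for q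
      by (induction q) (simp_all add: map_poly_pCons)
    have "z = complex_of_real a" using True by (simp add: a_def b_def complex_eq_iff)
    then have "poly r a = 0" using z E[of r] by simp
    then show thesis using linear by (auto simp: poly_eq_0_iff_dvd dvd_def)
  next
    case False
    define d where "d = [:a\<^sup>2 + b\<^sup>2, - 2 * a, 1:]"
    have d: "?E d z = 0"
      by (simp add: d_def map_poly_pCons complex_eq_iff a_def b_def power2_eq_square algebra_simps)
    define m where "m = r mod d"
    have r: "r = d * (r div d) + m" by (simp add: m_def)
    then have "?E m z = 0"
      using z d by (metis add_0 mult_zero_left poly_map_of_real_add poly_map_of_real_mult)
    moreover have "degree m < 2"
      using degree_mod_less'[of d r] degree_mod_less[of d r]
      by (cases "m = 0") (auto simp: m_def d_def)
    then obtain e f where m: "m = [:e, f:]"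
      by (metis degree_eq_zeroE degree_pCons_eq_if less_2_cases pCons_cases pCons_0_0 nat.inject One_nat_def)
    ultimately have "f * b = 0" "e + f * a = 0"
      by (simp_all add: map_poly_pCons complex_eq_iff a_def b_def algebra_simps)
    then have "m = 0" using False m by simp
    then show thesis using quadratic[of b a "r div d"] False r by (simp add: d_def)
  qed
qed

text \<open>
  The half of the spectral mapping theorem that bounds norms. Real quadratic factors
  \<open>(A - a)\<^sup>2 + b\<^sup>2\<close> are coercive for self-adjoint \<open>A\<close>, so invertibility of \<open>r(A)\<close> can only
  fail through a linear factor \<open>A - c\<close>, that is, at a point \<open>c\<close> of the real spectrum. The
  argument stays within real polynomials in \<open>A\<close>.
\<close>

lemma op_poly_not_invertible_root:
  fixes A :: "'a::complex_hilbert_space \<Rightarrow>\<^sub>L 'a"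
  assumes sa: "self_adjoint A"
  shows "r \<noteq> 0 \<Longrightarrow> \<not> op_invertible (op_poly r A) \<Longrightarrow> \<exists>x\<in>real_spectrum A. poly r x = 0"
proof (induction "degree r" arbitrary: r rule: less_induct)
  case less
  have step: "\<exists>x\<in>real_spectrum A. poly r x = 0"
    if r: "r = d * s" and d: "0 < degree d" "op_invertible (op_poly d A)" for d s
  proof -
    have "s \<noteq> 0" "degree s < degree r" using less.prems(1) r d by (auto simp: degree_mult_eq)
    moreover have "op_poly r A = op_poly d A o\<^sub>L op_poly s A"
      by (rule blinfun_eqI) (simp add: r op_poly_mult)
    then have "\<not> op_invertible (op_poly s A)"
      using less.prems(2) op_invertible_compose d(2) by metis
    ultimately show ?thesis using less.hyps[of s] by (auto simp: r)
  qed
  show ?case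
  proof (cases "degree r = 0")
    case True
    then obtain c where c: "r = [:c:]" by (rule degree_eq_zeroE)
    then have "op_invertible (op_poly r A)"
      using less.prems(1)
      by (intro op_invertibleI[where B = "(1 / c) *\<^sub>R id_blinfun"])
        (simp_all add: op_poly_pCons op_poly_0 blinfun.bilinear_simps)
    then show ?thesis using less.prems(2) by simp
  next
    case False
    then have "0 < degree r" by simp
    then show ?thesis
    proof (cases rule: real_poly_factor)
      case (linear c s)
      show ?thesis
      proof (cases "c \<in> real_spectrum A")
        case True
        then show ?thesis by (auto simp: linear)
      next
        case False
        then show ?thesis
          by (intro step[OF linear]) (simp_all add: real_spectrum_iff op_poly_linear)
      qed
    next
      case (quadratic a b s)
      have "op_invertible (op_poly [:a\<^sup>2 + b\<^sup>2, - 2 * a, 1:] A)"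
      proof (rule coercive_invertible)
        show "0 < b\<^sup>2" using quadratic by simp
        fix x
        have "inner x (op_poly [:a\<^sup>2 + b\<^sup>2, - 2 * a, 1:] A x)
            = (norm (A x - a *\<^sub>R x))\<^sup>2 + b\<^sup>2 * (norm x)\<^sup>2"
          by (simp add: op_poly_pCons op_poly_0 blinfun.bilinear_simps power2_norm_eq_inner
              inner_add_right inner_diff_left inner_diff_right self_adjoint_inner[OF sa]
              power2_eq_square[of a] algebra_simps)
        then show "b\<^sup>2 * (norm x)\<^sup>2 \<le> inner x (op_poly [:a\<^sup>2 + b\<^sup>2, - 2 * a, 1:] A x)"
          by simp
      qed
      then show ?thesis by (intro step[OF quadratic(2)]) simp_all
    qed
  qed
qed

text \<open>
  Vectors that almost attain the norm \<open>t\<close> of \<open>T\<close> are approximate eigenvectors of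
  \<open>T\<^sup>2\<close> for \<open>t\<^sup>2\<close>, since
  \<open>norm (T\<^sup>2 x - t\<^sup>2 x)\<^sup>2 \<le> 2 t\<^sup>2 (t\<^sup>2 norm x\<^sup>2 - norm (T x)\<^sup>2)\<close>. A bounded inverse would
  therefore improve the bound \<open>norm (T x) \<le> t norm x\<close> by a fixed factor.
\<close>

lemma square_minus_norm_square_not_invertible:
  fixes T :: "'a::complex_hilbert_space \<Rightarrow>\<^sub>L 'a"
  assumes sa: "self_adjoint T" and nz: "T \<noteq> 0"
  shows "\<not> op_invertible ((T o\<^sub>L T) - (norm T)\<^sup>2 *\<^sub>R id_blinfun)"
proof
  define t where "t = norm T"
  define D where "D = (T o\<^sub>L T) - t\<^sup>2 *\<^sub>R id_blinfun"
  assume "op_invertible ((T o\<^sub>L T) - (norm T)\<^sup>2 *\<^sub>R id_blinfun)"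
  then obtain B :: "'a \<Rightarrow>\<^sub>L 'a" where B: "\<And>x. B (D x) = x"
    using op_invertibleE unfolding D_def t_def by blast
  have t: "0 < t" using nz by (simp add: t_def)
  define K where "K = (norm B)\<^sup>2 * (2 * t\<^sup>2) + 1"
  have K: "1 \<le> K" by (simp add: K_def)
  have est: "(norm x)\<^sup>2 \<le> K * (t\<^sup>2 * (norm x)\<^sup>2 - (norm (T x))\<^sup>2)" for x
  proof -
    have le: "norm (T y) \<le> t * norm y" for y by (simp add: t_def norm_blinfun)
    have gap: "0 \<le> t\<^sup>2 * (norm x)\<^sup>2 - (norm (T x))\<^sup>2"
      using power_mono[OF le[of x], of 2] by (simp add: power_mult_distrib)
    have "norm (T (T x)) \<le> t * (t * norm x)"
      using le[of "T x"] le[of x] t by (meson less_imp_le mult_left_mono order_trans)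
    then have "(norm (T (T x)))\<^sup>2 \<le> (t * (t * norm x))\<^sup>2" by (intro power_mono) auto
    then have 4: "(norm (T (T x)))\<^sup>2 \<le> t\<^sup>2 * (t\<^sup>2 * (norm x)\<^sup>2)" by (simp add: power_mult_distrib)
    have "(norm (D x))\<^sup>2 = (norm (T (T x)))\<^sup>2 - 2 * t\<^sup>2 * (norm (T x))\<^sup>2 + t\<^sup>2 * (t\<^sup>2 * (norm x)\<^sup>2)"
      by (simp add: D_def blinfun.bilinear_simps power2_norm_eq_inner inner_diff_left
          inner_diff_right self_adjoint_inner[OF sa] algebra_simps)
    also have "\<dots> \<le> (2 * t\<^sup>2) * (t\<^sup>2 * (norm x)\<^sup>2 - (norm (T x))\<^sup>2)"
      using 4 by (simp add: algebra_simps)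
    finally have D: "(norm (D x))\<^sup>2 \<le> (2 * t\<^sup>2) * (t\<^sup>2 * (norm x)\<^sup>2 - (norm (T x))\<^sup>2)" .
    have "(norm x)\<^sup>2 \<le> (norm B)\<^sup>2 * (norm (D x))\<^sup>2"
      using norm_blinfun[of B "D x"] by (simp add: B power_mono flip: power_mult_distrib)
    also have "\<dots> \<le> (norm B)\<^sup>2 * ((2 * t\<^sup>2) * (t\<^sup>2 * (norm x)\<^sup>2 - (norm (T x))\<^sup>2))"
      by (intro mult_left_mono D) auto
    also have "\<dots> \<le> K * (t\<^sup>2 * (norm x)\<^sup>2 - (norm (T x))\<^sup>2)"
      using gap by (simp add: K_def algebra_simps)
    finally show ?thesis .
  qed
  (* The improved bound on the norm of T, contradicting the choice of t. *)
  define u where "u = sqrt (max 0 (t\<^sup>2 - 1 / K))"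
  have "norm T \<le> u"
  proof (rule norm_blinfun_bound)
    fix x
    have "(norm (T x))\<^sup>2 \<le> (t\<^sup>2 - 1 / K) * (norm x)\<^sup>2"
      using est[of x] K by (simp add: field_simps)
    also have "\<dots> \<le> max 0 (t\<^sup>2 - 1 / K) * (norm x)\<^sup>2" by (intro mult_right_mono) auto
    also have "\<dots> = (u * norm x)\<^sup>2" by (simp add: u_def power_mult_distrib)
    finally show "norm (T x) \<le> u * norm x" by (rule power2_le_imp_le) (simp add: u_def)
  qed (simp add: u_def)
  moreover have "u < t"
    unfolding u_def using t K by (intro real_less_lsqrt) auto
  ultimately show False by (simp add: t_def)
qed

lemma real_spectrum_nonempty:
  fixes A :: "'a::complex_hilbert_space \<Rightarrow>\<^sub>L 'a"
  assumes sa: "self_adjoint A" and nontriv: "(v :: 'a) \<noteq> 0"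
  shows "real_spectrum A \<noteq> {}"
proof (cases "A = 0")
  case True
  then have "\<not> op_invertible A" using nontriv by (auto elim!: op_invertibleE)
  then have "0 \<in> real_spectrum A" by (simp add: real_spectrum_iff)
  then show ?thesis by blast
next
  case False
  have "op_poly [:- (norm A)\<^sup>2, 0, 1:] A = (A o\<^sub>L A) - (norm A)\<^sup>2 *\<^sub>R id_blinfun"
    by (rule blinfun_eqI) (simp add: op_poly_pCons op_poly_0 blinfun.bilinear_simps)
  then show ?thesis
    using op_poly_not_invertible_root[OF sa, of "[:- (norm A)\<^sup>2, 0, 1:]"]
      square_minus_norm_square_not_invertible[OF sa False] by auto
qed

text \<open>
  If the norm \<open>t\<close> of \<open>q(A)\<close> exceeded the bound, then \<open>q(A)\<^sup>2 - t\<^sup>2\<close> would not be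
  invertible, and \<open>q\<^sup>2 - t\<^sup>2\<close> would have a root in the real spectrum.
\<close>

lemma norm_op_poly_le:
  fixes A :: "'a::complex_hilbert_space \<Rightarrow>\<^sub>L 'a"
  assumes sa: "self_adjoint A" and e: "0 \<le> e"
    and bound: "\<And>x. x \<in> real_spectrum A \<Longrightarrow> \<bar>poly q x\<bar> \<le> e"
  shows "norm (op_poly q A) \<le> e"
proof (rule ccontr)
  assume "\<not> norm (op_poly q A) \<le> e"
  moreover define T t where "T = op_poly q A" and "t = norm T"
  ultimately have t: "e < t" by simp
  have nz: "T \<noteq> 0" using t e by (auto simp: t_def)
  define r where "r = q * q - [:t\<^sup>2:]"
  have nroot: "poly r x \<noteq> 0" if "x \<in> real_spectrum A" for x
  proof
    assume "poly r x = 0"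
    then have "(poly q x)\<^sup>2 = t\<^sup>2" by (simp add: r_def power2_eq_square)
    then have "\<bar>poly q x\<bar> = \<bar>t\<bar>" by (simp add: power2_eq_iff abs_eq_iff)
    then show False using bound[OF that] t by simp
  qed
  (* If q is constant, q^2 - t^2 could be the zero polynomial; a point of the spectrum rules it out. *)
  obtain v where "T v \<noteq> 0" using nz by (metis blinfun_eqI zero_blinfun.rep_eq)
  then obtain x where "x \<in> real_spectrum A" using real_spectrum_nonempty[OF sa, of "T v"] by blast
  then have "r \<noteq> 0" using nroot by force
  moreover have "op_poly r A = (T o\<^sub>L T) - t\<^sup>2 *\<^sub>R id_blinfun"
    by (rule blinfun_eqI)
      (simp add: r_def T_def op_poly_diff op_poly_mult op_poly_pCons op_poly_0 blinfun.bilinear_simps)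
  then have "\<not> op_invertible (op_poly r A)"
    using square_minus_norm_square_not_invertible[OF _ nz] self_adjoint_op_poly[OF sa]
    by (simp add: T_def t_def)
  ultimately show False using op_poly_not_invertible_root[OF sa] nroot by blast
qed

section \<open>Continuous functional calculus\<close>

lemma real_spectrum_le_norm:
  assumes x: "x \<in> real_spectrum A"
  shows "x \<le> norm A"
proof (rule ccontr)
  assume *: "\<not> x \<le> norm A"
  have "(x - norm A) * (norm v)\<^sup>2 \<le> inner v ((- (A - x *\<^sub>R id_blinfun)) v)" for v
  proof -
    have "inner v (A v) \<le> norm A * (norm v)\<^sup>2"
      using Cauchy_Schwarz_ineq2[of v "A v"] mult_left_mono[OF norm_blinfun[of A v] norm_ge_zero[of v]]
      by (simp add: power2_eq_square algebra_simps)
    then show ?thesis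
      by (simp add: blinfun.bilinear_simps inner_diff_right power2_norm_eq_inner algebra_simps)
  qed
  then have "op_invertible (- (A - x *\<^sub>R id_blinfun))"
    using * by (intro coercive_invertible[of "x - norm A"]) auto
  then have "op_invertible (A - x *\<^sub>R id_blinfun)" using op_invertible_uminus by fastforce
  then show False using x by (simp add: real_spectrum_iff)
qed

lemma weierstrass_poly_sequence:
  fixes f :: "real \<Rightarrow> real"
  assumes "compact S" "continuous_on S f"
  obtains q :: "nat \<Rightarrow> real poly" where "uniform_limit S (\<lambda>k. poly (q k)) f sequentially"
proof -
  have "\<exists>q. \<forall>x\<in>S. \<bar>f x - poly q x\<bar> < 1 / Suc k" for k
  proof -
    obtain g where g: "real_polynomial_function g" "\<And>x. x \<in> S \<Longrightarrow> \<bar>f x - g x\<bar> < 1 / Suc k"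
      using Stone_Weierstrass_real_polynomial_function[OF assms, of "1 / Suc k"] by auto
    obtain a n where "g = (\<lambda>x. \<Sum>i\<le>n. a i * x ^ i)"
      using g(1) by (auto simp: real_polynomial_function_iff_sum)
    then have "g x = poly (\<Sum>i\<le>n. monom (a i) i) x" for x
      by (simp add: poly_sum poly_monom)
    then show ?thesis using g(2) by metis
  qed
  then obtain q where q: "\<And>k x. x \<in> S \<Longrightarrow> \<bar>f x - poly (q k) x\<bar> < 1 / Suc k" by metis
  have "uniform_limit S (\<lambda>k. poly (q k)) f sequentially"
  proof (rule uniform_limitI)
    fix e :: real assume "0 < e"
    then have "\<forall>\<^sub>F k in sequentially. 1 / real (Suc k) < e"
      using LIMSEQ_inverse_real_of_nat[THEN order_tendstoD(2), of e] by (simp add: inverse_eq_divide)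
    then show "\<forall>\<^sub>F k in sequentially. \<forall>x\<in>S. dist (poly (q k) x) (f x) < e"
    proof eventually_elim
      case (elim k)
      then show ?case
        using q by (metis abs_minus_commute dist_real_def less_trans)
    qed
  qed
  then show thesis by (rule that)
qed

locale functional_calculus =
  fixes A :: "'a::complex_hilbert_space \<Rightarrow>\<^sub>L 'a" and S :: "real set"
  assumes sa: "self_adjoint A" and compact: "compact S" and spec: "real_spectrum A \<subseteq> S"
begin

text \<open>
  The case \<open>f = g\<close>, \<open>e = 0\<close> shows that approximating polynomials give Cauchy sequences of
  operators with a common limit; the general case bounds the distance of two limits.
\<close>

lemma op_poly_difference_bound:
  assumes q: "uniform_limit (real_spectrum A) (\<lambda>k. poly (q k)) f sequentially"
    and r: "uniform_limit (real_spectrum A) (\<lambda>k. poly (r k)) g sequentially"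
    and fg: "\<And>x. x \<in> real_spectrum A \<Longrightarrow> \<bar>f x - g x\<bar> \<le> e" and e: "0 \<le> e" and d: "0 < d"
  shows "\<exists>N. \<forall>m\<ge>N. \<forall>n\<ge>N. norm (op_poly (q m) A - op_poly (r n) A) \<le> e + d"
proof -
  have d2: "0 < d / 2" using d by simp
  obtain N where N: "\<And>k x. k \<ge> N \<Longrightarrow> x \<in> real_spectrum A \<Longrightarrow> \<bar>poly (q k) x - f x\<bar> < d / 2"
      "\<And>k x. k \<ge> N \<Longrightarrow> x \<in> real_spectrum A \<Longrightarrow> \<bar>poly (r k) x - g x\<bar> < d / 2"
    using eventually_conj[OF uniform_limitD[OF q d2] uniform_limitD[OF r d2]]
    unfolding eventually_sequentially dist_real_def by blast
  have "norm (op_poly (q m - r n) A) \<le> e + d" if "m \<ge> N" "n \<ge> N" for m n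
  proof (rule norm_op_poly_le[OF sa])
    fix x assume x: "x \<in> real_spectrum A"
    show "\<bar>poly (q m - r n) x\<bar> \<le> e + d"
      using N(1)[OF that(1) x] N(2)[OF that(2) x] fg[OF x] by (simp add: abs_if split: if_splits)
  qed (use e d in simp)
  then show ?thesis by (auto simp: op_poly_diff)
qed

text \<open>
  This discharges the definite description in \<open>op_fun\<close>: the limit exists because
  polynomials in \<open>A\<close> are controlled by their values on the spectrum, and it is unique because the
  Weierstrass theorem supplies at least one approximating sequence.
\<close>

lemma op_poly_tendsto_op_fun:
  assumes f: "continuous_on S f"
    and q: "uniform_limit (real_spectrum A) (\<lambda>k. poly (q k)) f sequentially"
  shows "(\<lambda>k. op_poly (q k) A) \<longlonglongrightarrow> op_fun f A"
proof -
  obtain p where "uniform_limit S (\<lambda>k. poly (p k)) f sequentially"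
    using weierstrass_poly_sequence[OF compact f] by blast
  then have p: "uniform_limit (real_spectrum A) (\<lambda>k. poly (p k)) f sequentially"
    using spec by (rule uniform_limit_on_subset)
  have "Cauchy (\<lambda>k. op_poly (p k) A)"
  proof (rule CauchyI)
    fix e :: real assume "0 < e"
    then obtain N where
      "\<And>m n. m \<ge> N \<Longrightarrow> n \<ge> N \<Longrightarrow> norm (op_poly (p m) A - op_poly (p n) A) \<le> 0 + e / 2"
      using op_poly_difference_bound[OF p p, of 0 "e / 2"] by auto
    then show "\<exists>N. \<forall>m\<ge>N. \<forall>n\<ge>N. norm (op_poly (p m) A - op_poly (p n) A) < e"
      using \<open>0 < e\<close> by (intro exI[of _ N]) force
  qed
  then obtain T where T: "(\<lambda>k. op_poly (p k) A) \<longlonglongrightarrow> T"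
    by (auto simp: Cauchy_convergent_iff convergent_def)
  have any: "(\<lambda>k. op_poly (r k) A) \<longlonglongrightarrow> T"
    if r: "uniform_limit (real_spectrum A) (\<lambda>k. poly (r k)) f sequentially" for r
  proof -
    have "(\<lambda>k. op_poly (r k) A - op_poly (p k) A) \<longlonglongrightarrow> 0"
    proof (rule LIMSEQ_I)
      fix e :: real assume "0 < e"
      then obtain N where
        "\<And>m n. m \<ge> N \<Longrightarrow> n \<ge> N \<Longrightarrow> norm (op_poly (r m) A - op_poly (p n) A) \<le> 0 + e / 2"
        using op_poly_difference_bound[OF r p, of 0 "e / 2"] by auto
      then show "\<exists>N. \<forall>n\<ge>N. norm (op_poly (r n) A - op_poly (p n) A - 0) < e"
        using \<open>0 < e\<close> by (intro exI[of _ N]) force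
    qed
    from tendsto_add[OF this T] show ?thesis by simp
  qed
  have "op_fun f A = T"
    unfolding op_fun_def real_spectrum_def[symmetric]
  proof (rule the_equality)
    fix U
    assume "\<forall>q. uniform_limit (real_spectrum A) (\<lambda>k. poly (q k)) f sequentially \<longrightarrow>
      (\<lambda>k. op_poly (q k) A) \<longlonglongrightarrow> U"
    then show "U = T" using p T LIMSEQ_unique by blast
  qed (use any in blast)
  then show ?thesis using any[OF q] by simp
qed

lemma op_fun_approximation:
  assumes "continuous_on S f"
  obtains q where "uniform_limit S (\<lambda>k. poly (q k)) f sequentially"
    "(\<lambda>k. op_poly (q k) A) \<longlonglongrightarrow> op_fun f A"
proof -
  obtain q where q: "uniform_limit S (\<lambda>k. poly (q k)) f sequentially"
    using weierstrass_poly_sequence[OF compact assms] by blast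
  then show thesis
    using that op_poly_tendsto_op_fun[OF assms uniform_limit_on_subset[OF q spec]] by blast
qed

lemma op_fun_eq_op_poly:
  assumes "\<And>x. x \<in> S \<Longrightarrow> f x = poly q x"
  shows "op_fun f A = op_poly q A"
proof -
  have "continuous_on S (poly q)" by (intro continuous_intros)
  then have f: "continuous_on S f" using assms by (simp cong: continuous_on_cong)
  have "uniform_limit (real_spectrum A) (\<lambda>k::nat. poly q) f sequentially"
    using assms spec by (intro uniform_limitI) auto
  from op_poly_tendsto_op_fun[OF f this] show ?thesis
    by (simp add: LIMSEQ_const_iff)
qed

lemma op_fun_mult:
  assumes f: "continuous_on S f" and g: "continuous_on S g"
  shows "op_fun (\<lambda>x. f x * g x) A v = op_fun f A (op_fun g A v)"
proof -
  obtain q where q: "uniform_limit S (\<lambda>k. poly (q k)) f sequentially"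
      "(\<lambda>k. op_poly (q k) A) \<longlonglongrightarrow> op_fun f A"
    using op_fun_approximation[OF f] by blast
  obtain r where r: "uniform_limit S (\<lambda>k. poly (r k)) g sequentially"
      "(\<lambda>k. op_poly (r k) A) \<longlonglongrightarrow> op_fun g A"
    using op_fun_approximation[OF g] by blast
  have "bounded (f ` S)" "bounded (g ` S)"
    using compact f g by (auto intro: compact_imp_bounded compact_continuous_image)
  then have "uniform_limit S (\<lambda>k. poly (q k * r k)) (\<lambda>x. f x * g x) sequentially"
    using uniform_lim_mult[OF q(1) r(1)] by (simp add: poly_mult[abs_def])
  then have "(\<lambda>k. op_poly (q k * r k) A) \<longlonglongrightarrow> op_fun (\<lambda>x. f x * g x) A"
    using uniform_limit_on_subset spec by (intro op_poly_tendsto_op_fun continuous_intros f g) blast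
  then have "(\<lambda>k. op_poly (q k) A (op_poly (r k) A v)) \<longlonglongrightarrow> op_fun (\<lambda>x. f x * g x) A v"
    using tendsto_blinfun_at by (simp flip: op_poly_mult)
  moreover have "(\<lambda>k. op_poly (q k) A (op_poly (r k) A v)) \<longlonglongrightarrow> op_fun f A (op_fun g A v)"
    by (intro tendsto_intros q r)
  ultimately show ?thesis by (rule LIMSEQ_unique)
qed

lemma self_adjoint_op_fun: "continuous_on S f \<Longrightarrow> self_adjoint (op_fun f A)"
  by (metis op_fun_approximation self_adjoint_limit self_adjoint_op_poly sa)

lemma norm_op_fun_diff_le:
  assumes f: "continuous_on S f" and g: "continuous_on S g"
    and e: "0 \<le> e" "\<And>x. x \<in> S \<Longrightarrow> \<bar>f x - g x\<bar> \<le> e"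
  shows "norm (op_fun f A - op_fun g A) \<le> e"
proof (rule field_le_epsilon)
  fix d :: real assume d: "0 < d"
  obtain q where q: "uniform_limit S (\<lambda>k. poly (q k)) f sequentially"
      "(\<lambda>k. op_poly (q k) A) \<longlonglongrightarrow> op_fun f A"
    using op_fun_approximation[OF f] by blast
  obtain r where r: "uniform_limit S (\<lambda>k. poly (r k)) g sequentially"
      "(\<lambda>k. op_poly (r k) A) \<longlonglongrightarrow> op_fun g A"
    using op_fun_approximation[OF g] by blast
  obtain N where "\<And>k. k \<ge> N \<Longrightarrow> norm (op_poly (q k) A - op_poly (r k) A) \<le> e + d"
    using op_poly_difference_bound[OF uniform_limit_on_subset[OF q(1) spec]
        uniform_limit_on_subset[OF r(1) spec] _ e(1) d] e(2) spec by blast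
  moreover have "(\<lambda>k. norm (op_poly (q k) A - op_poly (r k) A)) \<longlonglongrightarrow> norm (op_fun f A - op_fun g A)"
    by (intro tendsto_intros q r)
  ultimately show "norm (op_fun f A - op_fun g A) \<le> e + d"
    using LIMSEQ_le_const2 by blast
qed

end

section \<open>Real powers of positive definite operators\<close>

text \<open>
  The spectrum lies between the coercivity constant and the norm, so it stays away from
  zero, where \<open>x \<mapsto> x powr p\<close> may be discontinuous.
\<close>

lemma pos_def_functional_calculus:
  fixes A :: "'a::complex_hilbert_space \<Rightarrow>\<^sub>L 'a"
  assumes "A \<in> pos_def"
  obtains S where "functional_calculus A S" "S \<subseteq> {0<..}"
proof -
  obtain m where m: "0 < m" "\<And>v. m * (norm v)\<^sup>2 \<le> inner v (A v)"
    using pos_def_coercive[OF assms] by blast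
  have "functional_calculus A {m..norm A}"
  proof
    show "self_adjoint A" by (rule pos_defD(1)[OF assms])
    show "real_spectrum A \<subseteq> {m..norm A}"
    proof
      fix x assume x: "x \<in> real_spectrum A"
      have "m \<le> x"
      proof (rule ccontr)
        assume "\<not> m \<le> x"
        moreover have "(m - x) * (norm v)\<^sup>2 \<le> inner v ((A - x *\<^sub>R id_blinfun) v)" for v
          using m(2)[of v]
          by (simp add: blinfun.bilinear_simps inner_diff_right power2_norm_eq_inner algebra_simps)
        ultimately have "op_invertible (A - x *\<^sub>R id_blinfun)"
          by (intro coercive_invertible[of "m - x"]) auto
        then show False using x by (simp add: real_spectrum_iff)
      qed
      then show "x \<in> {m..norm A}" using real_spectrum_le_norm[OF x] by simp
    qed
  qed simp
  then show thesis using that m(1) by fastforce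
qed

lemma continuous_on_powr_pos: "S \<subseteq> {0<..} \<Longrightarrow> continuous_on S (\<lambda>x::real. x powr p)"
  by (intro continuous_intros) auto

lemma op_powr_add:
  assumes "A \<in> pos_def"
  shows "op_powr A p (op_powr A q v) = op_powr A (p + q) v"
proof -
  obtain S where S: "functional_calculus A S" "S \<subseteq> {0<..}"
    using pos_def_functional_calculus[OF assms] by blast
  interpret functional_calculus A S by (rule S)
  show ?thesis
    unfolding op_powr_def powr_add
    by (rule op_fun_mult[symmetric]) (intro continuous_on_powr_pos S(2))+
qed

lemma op_powr_one:
  assumes "A \<in> pos_def" shows "op_powr A 1 = A"
proof -
  obtain S where S: "functional_calculus A S" "S \<subseteq> {0<..}"
    using pos_def_functional_calculus[OF assms] by blast
  interpret functional_calculus A S by (rule S)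
  have "op_powr A 1 = op_poly [:- 0, 1:] A"
    unfolding op_powr_def using S(2) by (intro op_fun_eq_op_poly) auto
  then show ?thesis unfolding op_poly_linear by simp
qed

lemma op_powr_zero:
  assumes "A \<in> pos_def" shows "op_powr A 0 = id_blinfun"
proof -
  obtain S where S: "functional_calculus A S" "S \<subseteq> {0<..}"
    using pos_def_functional_calculus[OF assms] by blast
  interpret functional_calculus A S by (rule S)
  have "op_powr A 0 = op_poly [:1:] A"
    unfolding op_powr_def using S(2) by (intro op_fun_eq_op_poly) auto
  also have "\<dots> = id_blinfun"
    by (rule blinfun_eqI) (simp add: op_poly_pCons op_poly_0 blinfun.bilinear_simps)
  finally show ?thesis .
qed

lemma op_powr_minus_cancel:
  assumes "A \<in> pos_def"
  shows "op_powr A p (op_powr A (- p) v) = v" "op_powr A (- p) (op_powr A p v) = v"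
  by (simp_all add: op_powr_add op_powr_zero assms)

lemma op_powr_pos_def:
  assumes "A \<in> pos_def"
  shows "op_powr A p \<in> pos_def"
proof (rule pos_defI_semidef)
  obtain S where S: "functional_calculus A S" "S \<subseteq> {0<..}"
    using pos_def_functional_calculus[OF assms] by blast
  have sa: "self_adjoint (op_powr A q)" for q
    unfolding op_powr_def
    by (intro functional_calculus.self_adjoint_op_fun[OF S(1)] continuous_on_powr_pos S(2))
  show "self_adjoint (op_powr A p)" by (rule sa)
  show "op_invertible (op_powr A p)"
    by (rule op_invertibleI[where B = "op_powr A (- p)"]) (simp_all add: op_powr_minus_cancel assms)
  show "0 \<le> inner v (op_powr A p v)" for v
  proof -
    have "inner v (op_powr A p v) = inner v (op_powr A (p / 2) (op_powr A (p / 2) v))"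
      by (simp add: op_powr_add assms)
    also have "\<dots> = (norm (op_powr A (p / 2) v))\<^sup>2"
      by (simp add: power2_norm_eq_inner self_adjoint_inner[OF sa])
    finally show ?thesis by simp
  qed
qed

text \<open>
  Uniform continuity of \<open>(p, x) \<mapsto> x powr p\<close> on a compact set makes \<open>x powr p k\<close>
  converge uniformly on the spectrum.
\<close>

lemma op_powr_tendsto:
  assumes A: "A \<in> pos_def" and p: "p \<longlonglongrightarrow> l"
  shows "(\<lambda>k. op_powr A (p k)) \<longlonglongrightarrow> op_powr A l"
proof (rule LIMSEQ_I)
  fix e :: real assume e: "0 < e"
  obtain S where S: "functional_calculus A S" "S \<subseteq> {0<..}"
    using pos_def_functional_calculus[OF A] by blast
  interpret functional_calculus A S by (rule S)
  let ?K = "cball l 1 \<times> S"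
  have "uniformly_continuous_on ?K (\<lambda>z. snd z powr fst z)"
    using S(2) by (intro compact_uniformly_continuous continuous_intros compact_Times compact) auto
  then obtain d where d: "0 < d"
      "\<And>z z'. z \<in> ?K \<Longrightarrow> z' \<in> ?K \<Longrightarrow> dist z' z < d \<Longrightarrow> dist (snd z' powr fst z') (snd z powr fst z) < e / 2"
    using e unfolding uniformly_continuous_on_def by (meson half_gt_zero)
  obtain N where N: "\<And>k. k \<ge> N \<Longrightarrow> dist (p k) l < min d 1"
    using p d(1) unfolding lim_sequentially by (metis min_less_iff_conj zero_less_one)
  have "norm (op_powr A (p k) - op_powr A l) < e" if "k \<ge> N" for k
  proof -
    have "norm (op_powr A (p k) - op_powr A l) \<le> e / 2"
      unfolding op_powr_def
    proof (rule norm_op_fun_diff_le)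
      fix x assume x: "x \<in> S"
      have "dist (p k, x) (l, x) < d" using N[OF that] by (simp add: dist_Pair_Pair)
      then have "dist (x powr p k) (x powr l) < e / 2"
        using d(2)[of "(l, x)" "(p k, x)"] x N[OF that] by (simp add: dist_commute)
      then show "\<bar>x powr p k - x powr l\<bar> \<le> e / 2" by (simp add: dist_real_def)
    qed (use e S(2) in \<open>auto intro: continuous_on_powr_pos\<close>)
    then show ?thesis using e by simp
  qed
  then show "\<exists>N. \<forall>k\<ge>N. norm (op_powr A (p k) - op_powr A l) < e" by blast
qed

section \<open>Order comparison through Riccati equations\<close>

text \<open>
  The square of \<open>T\<close> is coercive, and an inverse of the square yields one of \<open>T\<close>.
\<close>

lemma bounded_below_invertible:
  fixes T :: "'a::complex_hilbert_space \<Rightarrow>\<^sub>L 'a"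
  assumes sa: "self_adjoint T" and c: "0 < c" "\<And>x. c * norm x \<le> norm (T x)"
  shows "op_invertible T"
proof -
  have "op_invertible (T o\<^sub>L T)"
  proof (rule coercive_invertible)
    show "c\<^sup>2 * (norm x)\<^sup>2 \<le> inner x ((T o\<^sub>L T) x)" for x
      using power_mono[OF c(2), of x 2] c(1)
      by (simp add: power_mult_distrib power2_norm_eq_inner self_adjoint_inner[OF sa])
  qed (use c in simp)
  then obtain B :: "'a \<Rightarrow>\<^sub>L 'a" where B: "\<And>x. T (T (B x)) = x" "\<And>x. B (T (T x)) = x"
    by (metis op_invertibleE blinfun_apply_blinfun_compose)
  then have "T (B (T x)) = x" for x by metis
  then show ?thesis using B by (intro op_invertibleI[where B = "B o\<^sub>L T"]) simp_all
qed

text \<open>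
  Such an operator is the square of the self-adjoint operator \<open>op_fun sqrt K\<close>.
\<close>

lemma nonneg_if_spectrum_nonneg:
  fixes K :: "'a::complex_hilbert_space \<Rightarrow>\<^sub>L 'a"
  assumes sa: "self_adjoint K" and spec: "real_spectrum K \<subseteq> {0..}"
  shows "0 \<le> inner x (K x)"
proof -
  interpret functional_calculus K "{0..norm K}"
    using sa spec real_spectrum_le_norm[of _ K] by unfold_locales auto
  have cont: "continuous_on {0..norm K} sqrt" by (intro continuous_intros)
  let ?R = "op_fun sqrt K"
  have "op_fun (\<lambda>t. sqrt t * sqrt t) K = op_poly [:- 0, 1:] K"
    by (rule op_fun_eq_op_poly) simp
  then have "K x = ?R (?R x)"
    using op_fun_mult[OF cont cont, of x] unfolding op_poly_linear by simp
  then have "inner x (K x) = inner (?R x) (?R x)"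
    by (simp add: self_adjoint_inner[OF self_adjoint_op_fun[OF cont]])
  then show ?thesis by simp
qed

text \<open>
  The hypothesis says that \<open>K P + P K\<close> is positive semi-definite. For \<open>t < 0\<close> it forces
  \<open>inner ((K - t) x) (P x) \<ge> - t \<sqdot> inner x (P x)\<close>, so \<open>K - t\<close> is bounded below and the spectrum
  of \<open>K\<close> cannot contain \<open>t\<close>.
\<close>

lemma lyapunov_nonneg:
  fixes K P :: "'a::complex_hilbert_space \<Rightarrow>\<^sub>L 'a"
  assumes sa: "self_adjoint K" and P: "P \<in> pos_def" and KP: "\<And>x. 0 \<le> inner (K x) (P x)"
  shows "0 \<le> inner x (K x)"
proof (rule nonneg_if_spectrum_nonneg[OF sa])
  obtain m where m: "0 < m" "\<And>x. m * (norm x)\<^sup>2 \<le> inner x (P x)"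
    using pos_def_coercive[OF P] by blast
  define N where "N = norm P + 1"
  have N: "0 < N" "norm (P x) \<le> N * norm x" for x
    using norm_blinfun[of P x] norm_ge_zero[of P] norm_ge_zero[of x]
    by (auto simp: N_def algebra_simps simp del: norm_ge_zero)
  have "op_invertible (K - t *\<^sub>R id_blinfun)" if t: "t < 0" for t
  proof (rule bounded_below_invertible)
    show "self_adjoint (K - t *\<^sub>R id_blinfun)"
      by (intro self_adjoint_diff sa self_adjoint_scaleR self_adjoint_id)
    show "0 < - t * m / N" using t m N by (simp add: mult_neg_pos divide_neg_pos)
    fix x
    let ?y = "(K - t *\<^sub>R id_blinfun) x"
    have "(- t * m) * (norm x)\<^sup>2 \<le> - t * inner x (P x)"
      using mult_left_mono[OF m(2)[of x], of "- t"] t by simp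
    also have "\<dots> \<le> inner ?y (P x)"
      using KP[of x] by (simp add: blinfun.bilinear_simps inner_diff_left)
    also have "\<dots> \<le> norm ?y * norm (P x)"
      using Cauchy_Schwarz_ineq2[of ?y "P x"] by simp
    also have "\<dots> \<le> norm ?y * (N * norm x)" by (intro mult_left_mono N) simp
    finally have le: "norm x * ((- t * m) * norm x) \<le> norm x * (N * norm ?y)"
      by (simp add: power2_eq_square algebra_simps)
    have "(- t * m) * norm x \<le> N * norm ?y"
    proof (cases "x = 0")
      case False
      then show ?thesis using mult_left_le_imp_le le by (metis zero_less_norm_iff)
    qed (use N(1) in simp)
    then show "- t * m / N * norm x \<le> norm ?y" using N by (simp add: field_simps)
  qed
  then show "real_spectrum K \<subseteq> {0..}"
    by (auto simp: real_spectrum_iff not_less[symmetric])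
qed

text \<open>
  Operator monotonicity of the square root, written for \<open>D\<^sup>2 \<le> C\<^sup>2\<close>: with \<open>K = C - D\<close> and
  \<open>P = C + D\<close> one has \<open>K P + P K = 2 (C\<^sup>2 - D\<^sup>2)\<close>.
\<close>

lemma square_le_imp_le:
  assumes C: "C \<in> pos_def" and D: "D \<in> pos_def" and le: "\<And>x. norm (D x) \<le> norm (C x)"
  shows "inner x (D x) \<le> inner x (C x)"
proof -
  have "0 \<le> inner x ((C - D) x)"
  proof (rule lyapunov_nonneg)
    show "C + D \<in> pos_def" by (intro pos_def_add C D)
    show "self_adjoint (C - D)" by (intro self_adjoint_diff pos_defD(1) C D)
    have "inner ((C - D) x) ((C + D) x) = (norm (C x))\<^sup>2 - (norm (D x))\<^sup>2" for x
      by (simp add: blinfun.bilinear_simps inner_add_right inner_diff_left power2_norm_eq_inner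
          inner_commute[of "D x" "C x"])
    then show "0 \<le> inner ((C - D) x) ((C + D) x)" for x
      using power_mono[OF le, of x 2] by simp
  qed
  then show ?thesis by (simp add: blinfun.bilinear_simps inner_diff_right)
qed

text \<open>
  \<open>G R G \<le> H R H\<close> implies \<open>G \<le> H\<close>. Conjugation by \<open>S = R\<^sup>1\<^sup>/\<^sup>2\<close> turns the two sides into
  the squares of \<open>S G S\<close> and \<open>S H S\<close>. As the geometric mean of \<open>R\<^sup>-\<^sup>1\<close> and \<open>Q\<close> is the
  solution of \<open>G R G = Q\<close>, this expresses that the mean is monotone in \<open>Q\<close>.
\<close>

lemma riccati_comparison:
  assumes R: "R \<in> pos_def" and G: "G \<in> pos_def" and H: "H \<in> pos_def"
    and le: "\<And>x. inner (G x) (R (G x)) \<le> inner (H x) (R (H x))"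
  shows "inner x (G x) \<le> inner x (H x)"
proof -
  define S where "S = op_powr R (1/2)"
  have S: "S \<in> pos_def" by (simp add: S_def op_powr_pos_def R)
  have SS: "S (S y) = R y" for y
    by (simp add: S_def op_powr_add op_powr_one R)
  have sandwich: "S o\<^sub>L T o\<^sub>L S \<in> pos_def" if "T \<in> pos_def" for T
    by (intro pos_def_sandwich pos_defD S that)
  have norm_sandwich: "(norm ((S o\<^sub>L T o\<^sub>L S) y))\<^sup>2 = inner (T (S y)) (R (T (S y)))" for T y
    by (simp add: power2_norm_eq_inner pos_defD(4)[OF S] SS)
  have "norm ((S o\<^sub>L G o\<^sub>L S) y) \<le> norm ((S o\<^sub>L H o\<^sub>L S) y)" for y
    by (rule power2_le_imp_le) (simp_all only: norm_sandwich le norm_ge_zero)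
  then have "inner y ((S o\<^sub>L G o\<^sub>L S) y) \<le> inner y ((S o\<^sub>L H o\<^sub>L S) y)" for y
    by (intro square_le_imp_le sandwich G H)
  from this[of "op_inverse S x"] show ?thesis
    by (simp add: op_inverse_apply pos_defD(2)[OF S] flip: pos_defD(4)[OF S])
qed

text \<open>
  The solution is the geometric mean of the inverse of \<open>P\<close> with \<open>Q\<close>.
\<close>

lemma riccati_solution:
  assumes P: "P \<in> pos_def" and Q: "Q \<in> pos_def"
  obtains G where "G \<in> pos_def" "\<And>x. G (P (G x)) = Q x"
proof -
  define S where "S = op_powr P (1/2)"
  define T where "T = op_powr P (- 1/2)"
  define U where "U = op_powr (S o\<^sub>L Q o\<^sub>L S) (1/2)"
  have S: "S \<in> pos_def" and T: "T \<in> pos_def" by (simp_all add: S_def T_def op_powr_pos_def P)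
  have M: "S o\<^sub>L Q o\<^sub>L S \<in> pos_def" by (intro pos_def_sandwich pos_defD S Q)
  have U: "U \<in> pos_def" "U (U x) = S (Q (S x))" for x
    using op_powr_add[OF M, of "1/2" "1/2" x] by (simp_all add: U_def op_powr_pos_def op_powr_one M)
  have cancel: "S (T x) = x" "T (S x) = x" "T (P (T x)) = x" for x
  proof -
    show "S (T x) = x" "T (S x) = x"
      using op_powr_minus_cancel[OF P, of "1/2" x] by (simp_all add: S_def T_def)
    have "T (P (T x)) = op_powr P (- 1/2) (op_powr P 1 (op_powr P (- 1/2) x))"
      by (simp add: T_def op_powr_one P)
    then show "T (P (T x)) = x" by (simp add: op_powr_add op_powr_zero P)
  qed
  show thesis
  proof (rule that[of "T o\<^sub>L U o\<^sub>L T"])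
    show "T o\<^sub>L U o\<^sub>L T \<in> pos_def" by (intro pos_def_sandwich pos_defD T U)
    show "(T o\<^sub>L U o\<^sub>L T) (P ((T o\<^sub>L U o\<^sub>L T) x)) = Q x" for x
      by (simp add: cancel U)
  qed
qed

text \<open>
  Monotonicity of the square root, applied in both directions, shows that two positive
  roots have the same quadratic form.
\<close>

lemma op_powr_half_unique:
  assumes T: "T \<in> pos_def" and R: "R \<in> pos_def" and TT: "\<And>x. T (T x) = R x"
  shows "op_powr R (1/2) = T"
proof -
  define U where "U = op_powr R (1/2)"
  have U: "U \<in> pos_def" by (simp add: U_def op_powr_pos_def R)
  have UU: "U (U x) = R x" for x by (simp add: U_def op_powr_add op_powr_one R)
  have "(norm (U x))\<^sup>2 = (norm (T x))\<^sup>2" for x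
    by (simp add: power2_norm_eq_inner pos_defD(4)[OF U] pos_defD(4)[OF T] UU TT)
  then have "norm (U x) = norm (T x)" for x by (simp add: power2_eq_iff_nonneg)
  then have eq: "inner x (U x) = inner x (T x)" for x
    using square_le_imp_le[OF U T, of x] square_le_imp_le[OF T U, of x] by (simp add: order_antisym)
  then have "pos_semidef (U - T)"
    by (simp add: pos_semidef_iff self_adjoint_diff pos_defD U T blinfun.bilinear_simps inner_diff_right)
  from pos_semidef_norm_le[OF this] have "(U - T) x = 0" for x
    by (simp add: blinfun.bilinear_simps inner_diff_right eq)
  then show ?thesis unfolding U_def[symmetric] by (intro blinfun_eqI) (simp add: blinfun.bilinear_simps)
qed

section \<open>The Loewner--Heinz inequality\<close>

text \<open>
  Expand the quadratic form of \<open>X\<close> at the difference of the two inverse images of \<open>x\<close>.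
\<close>

lemma inverse_antimono:
  assumes X: "X \<in> pos_def" and Y: "Y \<in> pos_def" and le: "\<And>x. inner x (X x) \<le> inner x (Y x)"
  shows "inner x (op_inverse Y x) \<le> inner x (op_inverse X x)"
proof -
  define u v where "u = op_inverse Y x" and "v = op_inverse X x"
  have Yu: "Y u = x" and Xv: "X v = x"
    by (simp_all add: u_def v_def op_inverse_apply pos_defD X Y)
  have "0 \<le> inner (u - v) (X (u - v))" by (rule pos_defD(3)[OF X])
  also have "\<dots> = inner u (X u) - 2 * inner x u + inner x v"
    using pos_defD(4)[OF X, of v u]
    by (simp add: blinfun.bilinear_simps inner_diff_left inner_diff_right Xv inner_commute)
  also have "\<dots> \<le> inner x v - inner x u"
    using le[of u] by (simp add: Yu inner_commute)
  finally show ?thesis by (simp add: u_def v_def)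
qed

lemma op_inverse_op_powr:
  assumes "A \<in> pos_def" shows "op_inverse (op_powr A p) = op_powr A (- p)"
  by (intro op_inverse_eq blinfun_eqI) (simp_all add: op_powr_minus_cancel assms)

text \<open>
  Otherwise the points of \<open>E\<close> nearest to \<open>p\<close> from below and from above would have their
  midpoint, another point of \<open>E\<close>, strictly between them.
\<close>

lemma midpoint_closed_unit_interval:
  fixes E :: "real set"
  assumes E: "closed E" "0 \<in> E" "1 \<in> E"
    and mid: "\<And>p q. p \<in> E \<Longrightarrow> q \<in> E \<Longrightarrow> (p + q) / 2 \<in> E"
    and p: "0 \<le> p" "p \<le> 1"
  shows "p \<in> E"
proof (rule ccontr)
  assume np: "p \<notin> E"
  define a b where "a = Sup (E \<inter> {..p})" and "b = Inf (E \<inter> {p..})"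
  have bdd: "bdd_above (E \<inter> {..p})" "bdd_below (E \<inter> {p..})" by (auto intro: bdd_aboveI bdd_belowI)
  have a: "a \<in> E \<inter> {..p}"
    unfolding a_def using E p by (intro closed_contains_Sup bdd closed_Int) auto
  have b: "b \<in> E \<inter> {p..}"
    unfolding b_def using E p by (intro closed_contains_Inf bdd closed_Int) auto
  have ab: "a < p" "p < b" using a b np by (auto simp: less_le)
  have c: "(a + b) / 2 \<in> E" using mid a b by blast
  show False
  proof (cases "(a + b) / 2 \<le> p")
    case True
    then have "(a + b) / 2 \<le> a" unfolding a_def using c bdd by (intro cSup_upper) (auto simp: a_def)
    then show False using ab by simp
  next
    case False
    then have "b \<le> (a + b) / 2" unfolding b_def using c bdd by (intro cInf_lower) (auto simp: b_def)
    then show False using ab by simp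
  qed
qed

text \<open>
  The exponents for which the inequality holds form a closed set containing 0 and 1. It
  is closed under midpoints: the power \<open>G = A\<^sup>r\<close> with \<open>r = (p + q) / 2\<close> solves
  \<open>G A\<^sup>-\<^sup>p G = A\<^sup>q\<close>, and likewise for \<open>B\<close>, so the inequalities for \<open>p\<close> and \<open>q\<close> give
  \<open>A\<^sup>r A\<^sup>-\<^sup>p A\<^sup>r = A\<^sup>q \<le> B\<^sup>q = B\<^sup>r B\<^sup>-\<^sup>p B\<^sup>r \<le> B\<^sup>r A\<^sup>-\<^sup>p B\<^sup>r\<close>, which the Riccati comparison turns
  into \<open>A\<^sup>r \<le> B\<^sup>r\<close>.
\<close>

lemma loewner_heinz:
  assumes A: "A \<in> pos_def" and B: "B \<in> pos_def" and le: "\<And>x. inner x (A x) \<le> inner x (B x)"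
    and p: "0 \<le> p" "p \<le> 1"
  shows "inner x (op_powr A p x) \<le> inner x (op_powr B p x)"
proof -
  define E where "E = {p. \<forall>x. inner x (op_powr A p x) \<le> inner x (op_powr B p x)}"
  have "p \<in> E"
  proof (rule midpoint_closed_unit_interval[OF _ _ _ _ p])
    show "closed E"
      unfolding closed_sequential_limits
    proof (intro allI impI)
      fix s l assume s: "(\<forall>n. s n \<in> E) \<and> s \<longlonglongrightarrow> l"
      have lim: "(\<lambda>n. inner x (op_powr C (s n) x)) \<longlonglongrightarrow> inner x (op_powr C l x)"
        if "C \<in> pos_def" for C x
        using s by (intro tendsto_intros op_powr_tendsto that) simp
      have "inner x (op_powr A l x) \<le> inner x (op_powr B l x)" for x
        using s by (intro LIMSEQ_le[OF lim[OF A] lim[OF B]]) (auto simp: E_def)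
      then show "l \<in> E" by (simp add: E_def)
    qed
    show "0 \<in> E" "1 \<in> E" by (simp_all add: E_def op_powr_zero op_powr_one A B le)
    fix p q assume pE: "p \<in> E" and qE: "q \<in> E"
    define r where "r = (p + q) / 2"
    have r: "r + (r - p) = q" by (simp add: r_def field_simps)
    have sandwich: "inner (op_powr C r y) (op_powr C (- p) (op_powr C r y)) = inner y (op_powr C q y)"
      if "C \<in> pos_def" for C y
      by (simp add: pos_defD(4) op_powr_pos_def that op_powr_add r)
    have inv: "inner y (op_powr B (- p) y) \<le> inner y (op_powr A (- p) y)" for y
      using inverse_antimono[OF op_powr_pos_def[OF A] op_powr_pos_def[OF B], of p p y] pE
      by (simp add: E_def op_inverse_op_powr A B)
    have "inner y (op_powr A r y) \<le> inner y (op_powr B r y)" for y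
    proof (rule riccati_comparison[of "op_powr A (- p)"])
      fix y
      have "inner (op_powr A r y) (op_powr A (- p) (op_powr A r y)) \<le> inner y (op_powr B q y)"
        using qE by (simp add: sandwich A E_def)
      also have "\<dots> = inner (op_powr B r y) (op_powr B (- p) (op_powr B r y))"
        by (simp add: sandwich B)
      also have "\<dots> \<le> inner (op_powr B r y) (op_powr A (- p) (op_powr B r y))" by (rule inv)
      finally show "inner (op_powr A r y) (op_powr A (- p) (op_powr A r y))
        \<le> inner (op_powr B r y) (op_powr A (- p) (op_powr B r y))" .
    qed (simp_all add: op_powr_pos_def A B)
    then show "(p + q) / 2 \<in> E" by (simp add: E_def r_def)
  qed
  then show ?thesis by (simp add: E_def)
qed

section \<open>Near-order inequalities between powers\<close>

text \<open>
  Since \<open>G\<close> is positive definite with \<open>G P G = Q\<close>, it is the geometric mean of the inverse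
  of \<open>P\<close> with \<open>Q\<close>; so the near-order relation becomes a statement about a factor above the
  identity.
\<close>

lemma near_leI:
  fixes P Q G :: "'a::complex_hilbert_space \<Rightarrow>\<^sub>L 'a"
  assumes P: "P \<in> pos_def" and G: "G \<in> pos_def" "\<And>x. inner x x \<le> inner x (G x)"
    and GPG: "\<And>x. G (P (G x)) = Q x"
  shows "P \<preceq>\<^sub>N Q"
proof -
  define N where "N = op_inverse P"
  define S where "S = op_powr N (1/2)"
  define T where "T = op_powr N (- 1/2)"
  have N: "N \<in> pos_def" by (simp add: N_def pos_def_op_inverse P)
  have T: "T \<in> pos_def" by (simp add: T_def op_powr_pos_def N)
  have ST: "S (T x) = x" "T (S x) = x" for x
    using op_powr_minus_cancel[OF N, of "1/2" x] by (simp_all add: S_def T_def)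
  have TT: "T (T x) = P x" for x
  proof -
    have "T (T x) = op_powr N (- 1) (op_powr N 1 (P x))"
      by (simp add: T_def op_powr_add N op_powr_one) (simp add: N_def op_inverse_apply pos_defD P)
    then show ?thesis by (simp add: op_powr_minus_cancel N)
  qed
  have Q_eq: "Q = G o\<^sub>L P o\<^sub>L G" by (rule blinfun_eqI) (simp add: GPG)
  have Q: "Q \<in> pos_def"
    unfolding Q_eq by (intro pos_def_sandwich pos_defD G P)
  have "op_powr (T o\<^sub>L Q o\<^sub>L T) (1/2) = T o\<^sub>L G o\<^sub>L T"
    by (rule op_powr_half_unique)
      (simp_all add: TT GPG pos_def_sandwich pos_defD T G Q)
  then have "geometric_mean N Q = G"
    unfolding geometric_mean_def S_def[symmetric] T_def[symmetric]
    by (intro blinfun_eqI) (simp add: ST)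
  then show ?thesis
    using P Q G by (simp add: near_le_def N_def loewner_le_iff self_adjoint_id pos_defD)
qed

text \<open>
  From \<open>Y\<^sup>q = G X\<^sup>q G\<close> with \<open>G \<ge> I\<close> one gets
  \<open>Y\<^sup>2\<^sup>q = G X\<^sup>q G\<^sup>2 X\<^sup>q G \<ge> G X\<^sup>2\<^sup>q G\<close>. The factor \<open>H\<close> for the exponent \<open>2 q\<close> satisfies
  \<open>H X\<^sup>2\<^sup>q H = Y\<^sup>2\<^sup>q\<close>, hence \<open>H \<ge> G \<ge> I\<close> by the Riccati comparison.
\<close>

lemma near_power_doubling:
  fixes X Y G :: "'a::complex_hilbert_space \<Rightarrow>\<^sub>L 'a"
  assumes X: "X \<in> pos_def" and Y: "Y \<in> pos_def"
    and G: "\<And>x. inner x x \<le> inner x (G x)" "G \<in> pos_def"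
    and GXG: "\<And>x. G (op_powr X q (G x)) = op_powr Y q x"
  shows "\<exists>H\<in>pos_def. (\<forall>x. inner x x \<le> inner x (H x)) \<and>
    (\<forall>x. H (op_powr X (2 * q) (H x)) = op_powr Y (2 * q) x)"
proof -
  obtain H where H: "H \<in> pos_def" "\<And>x. H (op_powr X (2 * q) (H x)) = op_powr Y (2 * q) x"
    using riccati_solution[OF op_powr_pos_def[OF X] op_powr_pos_def[OF Y], of "2 * q" "2 * q"] by blast
  have double: "inner y (op_powr C (2 * q) y) = (norm (op_powr C q y))\<^sup>2" if "C \<in> pos_def" for C y
    by (simp add: power2_norm_eq_inner pos_defD(4) op_powr_pos_def op_powr_add that)
  have expand: "norm y \<le> norm (G y)" for y
  proof -
    have "norm y * norm y \<le> norm y * norm (G y)"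
      using G(1)[of y] Cauchy_Schwarz_ineq2[of y "G y"]
      by (simp add: power2_eq_square flip: power2_norm_eq_inner)
    then show ?thesis by (cases "y = 0") (simp_all add: mult_le_cancel_left)
  qed
  have "inner y (G y) \<le> inner y (H y)" for y
  proof (rule riccati_comparison[OF op_powr_pos_def[OF X] G(2) H(1)])
    fix y
    have "inner (G y) (op_powr X (2 * q) (G y)) \<le> (norm (G (op_powr X q (G y))))\<^sup>2"
      unfolding double[OF X] by (intro power_mono expand) simp
    also have "\<dots> = inner y (op_powr Y (2 * q) y)" by (simp add: GXG double Y)
    also have "\<dots> = inner (H y) (op_powr X (2 * q) (H y))"
      by (simp add: pos_defD(4)[OF H(1)] H(2))
    finally show "inner (G y) (op_powr X (2 * q) (G y)) \<le> inner (H y) (op_powr X (2 * q) (H y))" .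
  qed
  then show ?thesis using H G(1) by (meson order_trans)
qed

text \<open>
  Powers above one do not preserve the Loewner order, but they do map it into the
  near-order. For \<open>q \<le> 1\<close> this follows from the Loewner--Heinz inequality, as the factor \<open>G\<close>
  satisfies \<open>G X\<^sup>q G = Y\<^sup>q \<ge> I X\<^sup>q I\<close>; larger exponents are reached by repeated doubling.
\<close>

lemma near_power:
  assumes X: "X \<in> pos_def" and Y: "Y \<in> pos_def" and le: "\<And>x. inner x (X x) \<le> inner x (Y x)"
    and q: "0 \<le> q"
  shows "\<exists>G\<in>pos_def. (\<forall>x. inner x x \<le> inner x (G x)) \<and>
    (\<forall>x. G (op_powr X q (G x)) = op_powr Y q x)"
proof -
  obtain k :: nat where k: "q \<le> 2 ^ k"
    using real_arch_pow[of 2 q] by (auto intro: less_imp_le)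
  have "0 \<le> q \<Longrightarrow> q \<le> 2 ^ k \<Longrightarrow> \<exists>G\<in>pos_def. (\<forall>x. inner x x \<le> inner x (G x)) \<and>
    (\<forall>x. G (op_powr X q (G x)) = op_powr Y q x)" for q :: real
  proof (induction k arbitrary: q)
    case 0
    obtain G where G: "G \<in> pos_def" "\<And>x. G (op_powr X q (G x)) = op_powr Y q x"
      using riccati_solution[OF op_powr_pos_def[OF X] op_powr_pos_def[OF Y]] by blast
    have one: "id_blinfun \<in> pos_def"
      by (rule pos_defI[of _ 1]) (simp_all add: self_adjoint_id power2_norm_eq_inner)
    have "inner x (id_blinfun x) \<le> inner x (G x)" for x
    proof (rule riccati_comparison[OF op_powr_pos_def[OF X] one G(1)])
      show "inner (id_blinfun y) (op_powr X q (id_blinfun y)) \<le> inner (G y) (op_powr X q (G y))" for y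
        using loewner_heinz[OF X Y le, of q y] 0 by (simp add: pos_defD(4)[OF G(1)] G(2))
    qed
    then show ?case using G by auto
  next
    case (Suc k)
    then have "0 \<le> q / 2" "q / 2 \<le> 2 ^ k" by simp_all
    then obtain G where "G \<in> pos_def" "\<And>x. inner x x \<le> inner x (G x)"
        "\<And>x. G (op_powr X (q / 2) (G x)) = op_powr Y (q / 2) x"
      using Suc.IH by metis
    then show ?case using near_power_doubling[OF X Y, of G "q / 2"] by simp
  qed
  then show ?thesis using k q by blast
qed

lemma weighted_sum_mono:
  fixes F H :: "'i \<Rightarrow> ('a::real_inner \<Rightarrow>\<^sub>L 'a)"
  assumes "\<And>j. j \<in> J \<Longrightarrow> (0::real) < w j"
    and "\<And>j. j \<in> J \<Longrightarrow> inner x (F j x) \<le> inner x (H j x)"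
  shows "inner x ((\<Sum>j\<in>J. w j *\<^sub>R F j) x) \<le> inner x ((\<Sum>j\<in>J. w j *\<^sub>R H j) x)"
  using assms
  by (simp add: blinfun.sum_left blinfun.scaleR_left inner_sum_right sum_mono)

theorem theorem4p2:
  fixes n :: nat
    and A B :: "nat \<Rightarrow> ('a::complex_hilbert_space \<Rightarrow>\<^sub>L 'a)"
    and w :: "nat \<Rightarrow> real"
    and p :: real
  assumes "\<And>j. j \<in> {1..n} \<Longrightarrow> A j \<in> pos_def"
    and "\<And>j. j \<in> {1..n} \<Longrightarrow> B j \<in> pos_def"
    and "w \<in> pos_prob_vectors n"
    and "\<And>j. j \<in> {1..n} \<Longrightarrow> A j \<le>\<^sub>L B j"
    and "0 < p \<and> p \<le> 1 \<or> -1 \<le> p \<and> p < 0"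
  shows "quasi_arith_mean p n w A \<preceq>\<^sub>N quasi_arith_mean p n w B"
proof -
  define X where "X = (\<Sum>j=1..n. w j *\<^sub>R op_powr (A j) p)"
  define Y where "Y = (\<Sum>j=1..n. w j *\<^sub>R op_powr (B j) p)"
  have w: "0 < w j" if "j \<in> {1..n}" for j using assms(3) that by (simp add: pos_prob_vectors_def)
  have n: "{1..n} \<noteq> {}" using assms(3) unfolding pos_prob_vectors_def by (metis (mono_tags) mem_Collect_eq sum.empty zero_neq_one)
  have X: "X \<in> pos_def" and Y: "Y \<in> pos_def"
    unfolding X_def Y_def
    by (intro pos_def_weighted_sum op_powr_pos_def; use n w assms(1,2) in simp)+
  have heinz: "inner x (op_powr (A j) r x) \<le> inner x (op_powr (B j) r x)"
    if "j \<in> {1..n}" "0 \<le> r" "r \<le> 1" for j r x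
    using assms(1,2,4)[OF that(1)] that(2,3) by (intro loewner_heinz) (auto simp: loewner_le_iff)
  show ?thesis
    unfolding quasi_arith_mean_def X_def[symmetric] Y_def[symmetric]
    using assms(5)
  proof
    assume p: "0 < p \<and> p \<le> 1"
    have "inner x (X x) \<le> inner x (Y x)" for x
      unfolding X_def Y_def using p by (intro weighted_sum_mono w heinz) auto
    then obtain G where "G \<in> pos_def" "\<And>x. inner x x \<le> inner x (G x)"
        "\<And>x. G (op_powr X (1 / p) (G x)) = op_powr Y (1 / p) x"
      using near_power[OF X Y, of "1 / p"] p by auto
    then show "op_powr X (1 / p) \<preceq>\<^sub>N op_powr Y (1 / p)"
      by (intro near_leI[of _ G] op_powr_pos_def X)
  next
    assume p: "-1 \<le> p \<and> p < 0"
    have "inner x (op_powr (B j) p x) \<le> inner x (op_powr (A j) p x)" if j: "j \<in> {1..n}" for j x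
      using inverse_antimono[OF op_powr_pos_def[OF assms(1)[OF j]] op_powr_pos_def[OF assms(2)[OF j]],
          of "- p" "- p" x] heinz[OF j, of "- p"] p
      by (simp add: op_inverse_op_powr[OF assms(1)[OF j]] op_inverse_op_powr[OF assms(2)[OF j]])
    then have "inner x (Y x) \<le> inner x (X x)" for x
      unfolding X_def Y_def by (intro weighted_sum_mono w) auto
    then obtain G where G: "G \<in> pos_def" "\<And>x. inner x x \<le> inner x (G x)"
        "\<And>x. G (op_powr Y (- 1 / p) (G x)) = op_powr X (- 1 / p) x"
      using near_power[OF Y X, of "- 1 / p"] p by (auto simp: divide_simps)
    (* Inverting G Y^r G = X^r, where r = - 1 / p, gives G X^(-r) G = Y^(-r): the same factor works. *)
    have "G (op_powr X (1 / p) (G x)) = op_powr Y (1 / p) x" for x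
    proof -
      define y where "y = op_inverse G (op_powr Y (1 / p) x)"
      have Gy: "G y = op_powr Y (1 / p) x" by (simp add: y_def op_inverse_apply pos_defD G)
      then have "op_powr X (- 1 / p) y = G x"
        using G(3)[of y] op_powr_minus_cancel(2)[OF Y, of "1 / p" x] by simp
      then show ?thesis
        using op_powr_minus_cancel(1)[OF X, of "1 / p" y] Gy by simp
    qed
    then show "op_powr X (1 / p) \<preceq>\<^sub>N op_powr Y (1 / p)"
      using G by (intro near_leI[of _ G] op_powr_pos_def X)
  qed
qed

end
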